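(* Let $\mathcal T$ be a locally finite tree with at least $3$ edges at each vertex and let $o$ be a distinguished vertex of $\mathcal T$. Let $\Gamma$ be a group acting by automorphisms of $\mathcal T$ such that the stabilizer $\Gamma_0$ of $o$ in $\Gamma$ is a proper subgroup of $\Gamma$ and acts transitively on each sphere around $o$. (Then $\mathcal T$ is semi-homogeneous, $(\Gamma,\Gamma_0)$ is a Hecke pair, and $\Gamma$ has either one or two orbits on the vertex set $\mathcal T^0$.) Let $q_0+1$ (respectively $q_1+1$) denote the degree of the vertices at even (respectively odd) distance from $o$, and put $q:=q_0$ if $\mathcal T$ is homogeneous. For $n\in\mathbb N=\{0,1,2,\dots\}$ let $\Gamma_n:=\{\gamma\in\Gamma : d(\gamma\cdot o,o)=n\}$; the canonical basis of $\mathbb C[\Gamma,\Gamma_0]$ is $\{\Gamma_n: n\in\mathbb N\}$ if $\Gamma$ is transitive on $\mathcal T^0$, and $\{\Gamma_{2n}: n\in\mathbb N\}$ if $\Gamma$ has two orbits on $\mathcal T^0$. The complete multiplication table for the elements of the canonical basis of $\mathbb C[\Gamma,\Gamma_0]$ is given by: (1) if $\Gamma$ acts transitively on $\mathcal T^0$, then for $m\ge n>0$ $$\Gamma_n\Gamma_m=\Gamma_m\Gamma_n=\Gamma_{m+n}+q^{n-1}(q+\delta_{mn})\Gamma_{m-n}+(q-1)\sum_{l=1}^{n-1}q^{l-1}\,\Gamma_{m+n-2l};$$ (2) if $\Gamma$ acts with two orbits on $\mathcal T^0$, letting $q_l=q_0$ for $l$ even and $q_l=q_1$ for $l$ odd,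 then for $m\ge n>0$ $$\Gamma_{2n}\Gamma_{2m}=\Gamma_{2m}\Gamma_{2n}=\Gamma_{2(m+n)}+q_1^{n}q_0^{n-1}(q_0+\delta_{mn})\Gamma_{2(m-n)}+\sum_{l=1}^{2n-1}(q_l-1)\Bigl(\prod_{i=1}^{l-1}q_i\Bigr)\Gamma_{2(m+n-l)} .$$
   Context: Hecke algebras. A pair $(G,H)$ of a group and a subgroup is a Hecke pair if every double coset $HgH$ is a finite union of right cosets $Hx$ (equivalently, every double coset is a finite union of left cosets $xH$; equivalently, for all $g\in G$ the subgroup $H\cap gHg^{-1}$ has finite index in both $H$ and $gHg^{-1}$). For a Hecke pair, $\mathbb Z[G,H]$ is the free $\mathbb Z$-module on the set $H\backslash G/H$ of double cosets (the canonical basis) with the associative multiplication $$HgH\cdot Hg'H=\sum_{HxH\in H\backslash G/H}\alpha(g,g';x)\,HxH,\qquad \alpha(g,g';x)=\#\{(i,j): g_ig'_j\in Hx\},$$ where $HgH=\bigsqcup_i Hg_i$ and $Hg'H=\bigsqcup_j Hg'_j$. Its unit is $H$. Put $\mathbb C[G,H]=\mathbb Z[G,H]\otimes_{\mathbb Z}\mathbb C$. Trees. $d$ is the graph distance on the vertex set; the sphere of radius $n$ around $o$ is the set of vertices at distance $n$ from $o$. A tree is semi-homogeneous if all vertices of the same type (class of the bipartition of the vertex set by parity of distance) have the same degree, and homogeneous if all vertices have the same degree. $\delta_{mn}$ is the Kronecker delta. A double coset of $\Gamma_0$ is identified with its underlying subset of $\Gamma$; the empty product is $1$ and the empty sum is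 $0$. *)

theory Defs
  imports Complex_Main "HOL-Algebra.Group_Action" "HOL-Library.Poly_Mapping"
begin

section \<open>Simple graphs and trees\<close>

text \<open>
  A simple graph, possibly infinite, is a vertex set together with an adjacency relation. The
  predicate \<open>tree\<close> of the Graph_Theory entry is not used: it forbids \<^emph>\<open>directed\<close>
  cycles, so that a symmetric digraph satisfying it has no edges.
\<close>

definition simple_graph :: "'v set \<Rightarrow> ('v \<Rightarrow> 'v \<Rightarrow> bool) \<Rightarrow> bool" where
  "simple_graph V adj \<longleftrightarrow>
     (\<forall>x y. adj x y \<longrightarrow> x \<in> V \<and> y \<in> V \<and> x \<noteq> y \<and> adj y x)"

definition walk_betw ::
    "'v set \<Rightarrow> ('v \<Rightarrow> 'v \<Rightarrow> bool) \<Rightarrow> 'v \<Rightarrow> 'v list \<Rightarrow> 'v \<Rightarrow> bool" where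
  "walk_betw V adj x p y \<longleftrightarrow>
     p \<noteq> [] \<and> set p \<subseteq> V \<and> successively adj p \<and> hd p = x \<and> last p = y"

definition graph_connected :: "'v set \<Rightarrow> ('v \<Rightarrow> 'v \<Rightarrow> bool) \<Rightarrow> bool" where
  "graph_connected V adj \<longleftrightarrow> V \<noteq> {} \<and> (\<forall>x\<in>V. \<forall>y\<in>V. \<exists>p. walk_betw V adj x p y)"

text \<open>A cycle is given by the list of its vertices, the first one not being repeated at the end.\<close>

definition graph_cycle :: "'v set \<Rightarrow> ('v \<Rightarrow> 'v \<Rightarrow> bool) \<Rightarrow> 'v list \<Rightarrow> bool" where
  "graph_cycle V adj c \<longleftrightarrow>
     length c \<ge> 3 \<and> distinct c \<and> set c \<subseteq> V \<and> successively adj c \<and> adj (last c) (hd c)"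

definition is_tree :: "'v set \<Rightarrow> ('v \<Rightarrow> 'v \<Rightarrow> bool) \<Rightarrow> bool" where
  "is_tree V adj \<longleftrightarrow>
     simple_graph V adj \<and> graph_connected V adj \<and> \<not> (\<exists>c. graph_cycle V adj c)"

definition graph_nbrs :: "('v \<Rightarrow> 'v \<Rightarrow> bool) \<Rightarrow> 'v \<Rightarrow> 'v set" where
  "graph_nbrs adj x = {y. adj x y}"

definition graph_degree :: "('v \<Rightarrow> 'v \<Rightarrow> bool) \<Rightarrow> 'v \<Rightarrow> nat" where
  "graph_degree adj x = card (graph_nbrs adj x)"

definition locally_finite_graph :: "'v set \<Rightarrow> ('v \<Rightarrow> 'v \<Rightarrow> bool) \<Rightarrow> bool" where
  "locally_finite_graph V adj \<longleftrightarrow> (\<forall>x\<in>V. finite (graph_nbrs adj x))"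

text \<open>The length of a walk is its number of edges, one less than its number of vertices.\<close>

definition graph_dist :: "'v set \<Rightarrow> ('v \<Rightarrow> 'v \<Rightarrow> bool) \<Rightarrow> 'v \<Rightarrow> 'v \<Rightarrow> nat" where
  "graph_dist V adj x y = (LEAST n. \<exists>p. walk_betw V adj x p y \<and> length p = Suc n)"

definition graph_sphere :: "'v set \<Rightarrow> ('v \<Rightarrow> 'v \<Rightarrow> bool) \<Rightarrow> 'v \<Rightarrow> nat \<Rightarrow> 'v set" where
  "graph_sphere V adj v n = {x \<in> V. graph_dist V adj v x = n}"

definition semi_homogeneous :: "'v set \<Rightarrow> ('v \<Rightarrow> 'v \<Rightarrow> bool) \<Rightarrow> bool" where
  "semi_homogeneous V adj \<longleftrightarrow>
     (\<forall>x\<in>V. \<forall>y\<in>V. even (graph_dist V adj x y) \<longrightarrow> graph_degree adj x = graph_degree adj y)"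

definition homogeneous :: "'v set \<Rightarrow> ('v \<Rightarrow> 'v \<Rightarrow> bool) \<Rightarrow> bool" where
  "homogeneous V adj \<longleftrightarrow> (\<forall>x\<in>V. \<forall>y\<in>V. graph_degree adj x = graph_degree adj y)"

definition graph_automorphism ::
    "'v set \<Rightarrow> ('v \<Rightarrow> 'v \<Rightarrow> bool) \<Rightarrow> ('v \<Rightarrow> 'v) \<Rightarrow> bool" where
  "graph_automorphism V adj f \<longleftrightarrow>
     bij_betw f V V \<and> (\<forall>x\<in>V. \<forall>y\<in>V. adj (f x) (f y) \<longleftrightarrow> adj x y)"


section \<open>Hecke algebras\<close>

definition double_coset :: "('a, 'b) monoid_scheme \<Rightarrow> 'a set \<Rightarrow> 'a \<Rightarrow> 'a set" where
  "double_coset G H g = (H #>\<^bsub>G\<^esub> g) <#>\<^bsub>G\<^esub> H"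

definition double_cosets :: "('a, 'b) monoid_scheme \<Rightarrow> 'a set \<Rightarrow> 'a set set" where
  "double_cosets G H = double_coset G H ` carrier G"

definition right_cosets_in :: "('a, 'b) monoid_scheme \<Rightarrow> 'a set \<Rightarrow> 'a set \<Rightarrow> 'a set set" where
  "right_cosets_in G H D = {C \<in> rcosets\<^bsub>G\<^esub> H. C \<subseteq> D}"

definition hecke_pair :: "('a, 'b) monoid_scheme \<Rightarrow> 'a set \<Rightarrow> bool" where
  "hecke_pair G H \<longleftrightarrow> group G \<and> subgroup H G \<and>
     (\<forall>D \<in> double_cosets G H. \<exists>F. finite F \<and> F \<subseteq> rcosets\<^bsub>G\<^esub> H \<and> D = \<Union>F)"

definition coset_rep :: "'a set \<Rightarrow> 'a" where
  "coset_rep C = (SOME g. g \<in> C)"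

text \<open>
  If \<open>D\<close> is the disjoint union of the right cosets \<open>H g\<^sub>i\<close> and \<open>D'\<close> that of the right cosets
  \<open>H g'\<^sub>j\<close>, then \<open>hecke_coeff G H D D' x\<close> is the number of pairs \<open>(i, j)\<close> with
  \<open>g\<^sub>i g'\<^sub>j \<in> H x\<close>. The indices are the cosets themselves, and \<open>g\<^sub>i\<close>, \<open>g'\<^sub>j\<close> are
  their chosen representatives. For a Hecke pair the number does not depend on this choice, and it
  depends on \<open>x\<close> only through the double coset of \<open>x\<close>.
\<close>

definition hecke_coeff ::
    "('a, 'b) monoid_scheme \<Rightarrow> 'a set \<Rightarrow> 'a set \<Rightarrow> 'a set \<Rightarrow> 'a \<Rightarrow> nat" where
  "hecke_coeff G H D D' x =
     card {(C, C'). C \<in> right_cosets_in G H D \<and> C' \<in> right_cosets_in G H D' \<and>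
                    coset_rep C \<otimes>\<^bsub>G\<^esub> coset_rep C' \<in> H #>\<^bsub>G\<^esub> x}"

text \<open>
  Over a commutative coefficient ring \<open>'r\<close>, the Hecke algebra is the free module on
  the double cosets, i.e. the finitely supported functions of type \<open>'a set \<Rightarrow>\<^sub>0 'r\<close>
  whose support consists of double cosets. The integers give \<open>\<int>[G,H]\<close>; the complex numbers give
  \<open>\<complex>[G,H]\<close>, with the same structure constants on the canonical basis. The multiplication of the
  type \<open>'a set \<Rightarrow>\<^sub>0 'r\<close> provided by Poly_Mapping is unrelated and is not used.
\<close>

definition hecke_scale :: "'r \<Rightarrow> ('a set \<Rightarrow>\<^sub>0 'r) \<Rightarrow> ('a set \<Rightarrow>\<^sub>0 'r::comm_ring_1)"
    (infixr "*\<^sub>H" 75) where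
  "c *\<^sub>H f = Poly_Mapping.map (\<lambda>a. c * a) f"

definition hecke_basis :: "'a set \<Rightarrow> ('a set \<Rightarrow>\<^sub>0 'r::comm_ring_1)" where
  "hecke_basis D = Poly_Mapping.single D 1"

definition canonical_basis ::
    "('a, 'b) monoid_scheme \<Rightarrow> 'a set \<Rightarrow> ('a set \<Rightarrow>\<^sub>0 'r::comm_ring_1) set" where
  "canonical_basis G H = hecke_basis ` double_cosets G H"

text \<open>
  The sum below ranges over the double cosets with non-zero coefficient, of which there are finitely
  many for a Hecke pair.
\<close>

definition hecke_basis_mult ::
    "('a, 'b) monoid_scheme \<Rightarrow> 'a set \<Rightarrow> 'a set \<Rightarrow> 'a set \<Rightarrow> ('a set \<Rightarrow>\<^sub>0 'r::comm_ring_1)"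
  where
  "hecke_basis_mult G H D D' =
     (\<Sum>X \<in> {X \<in> double_cosets G H. hecke_coeff G H D D' (coset_rep X) \<noteq> 0}.
        of_nat (hecke_coeff G H D D' (coset_rep X)) *\<^sub>H hecke_basis X)"

definition hecke_mult ::
    "('a, 'b) monoid_scheme \<Rightarrow> 'a set \<Rightarrow> ('a set \<Rightarrow>\<^sub>0 'r) \<Rightarrow> ('a set \<Rightarrow>\<^sub>0 'r)
       \<Rightarrow> ('a set \<Rightarrow>\<^sub>0 'r::comm_ring_1)" where
  "hecke_mult G H f f' =
     (\<Sum>D \<in> Poly_Mapping.keys f. \<Sum>D' \<in> Poly_Mapping.keys f'.
        (Poly_Mapping.lookup f D * Poly_Mapping.lookup f' D') *\<^sub>H hecke_basis_mult G H D D')"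

end

(*
  A right coset \<Gamma>0 g corresponds to the vertex g^{-1} o, and the coefficient of \<Gamma>_k in
  \<Gamma>_N \<Gamma>_M becomes the number of vertices at distance M from o and N from w, for any
  vertex w of the orbit of o at distance k from o. In a tree such vertices exist only if
  M + N = k + 2l with l \<le> min M N. They are then the endpoints of the paths of length l which
  start at the vertex p of the geodesic from o to w with d(o,p) = M - l and leave that
  geodesic at p: one first excludes the (at most two) neighbours of p on the geodesic and then
  branches freely. The set of distances realised by the orbit of o is closed under
  (k, j) \<mapsto> k + j - 2l because of the branching at each vertex; hence it is either
  everything or the set of even numbers.
*)
theory Submission
  imports Defs
begin

section \<open>Distances and counting in trees\<close>

text \<open>Why a coefficient counts vertices: \<open>g g' \<in> H x\<close> means that
  \<open>inv g\<close> and \<open>g' (inv x)\<close> agree on \<open>v0\<close>. So the coset of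
  \<open>g\<close> is determined by that of \<open>g'\<close>, and applying \<open>inv g'\<close>
  turns the remaining condition into one on the distance between \<open>v = inv g' v0\<close> and
  \<open>w = inv x v0\<close>. The count depends symmetrically on the two radii, which is the source
  of commutativity.

  The geometry rests on one consequence of the absence of cycles: at most one neighbour of
  \<open>x\<close> is not farther from \<open>y\<close> than \<open>x\<close>. Being on a geodesic
  is then an equation between distances that can be tested on neighbours.

  Both cases of the table come from one count. At \<open>l\<close> steps before its end, a path that
  ends in the orbit of \<open>v0\<close> meets a vertex of degree \<open>q l + 1\<close>: with two
  orbits because the orbit is the set of vertices at even distance, in the transitive case because
  \<open>q0 = q1\<close>. Hence the conditions of the form
  \<open>even _ \<or> q0 = q1\<close>.\<close>

lemma distinct_walk_exists:
  assumes "successively R p" "p \<noteq> []"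
  shows "\<exists>q. q \<noteq> [] \<and> distinct q \<and> successively R q \<and> set q \<subseteq> set p \<and> hd q = hd p \<and> last q = last p"
  using assms
proof (induction p rule: length_induct)
  case (1 p)
  show ?case
  proof (cases "distinct p")
    case True
    then show ?thesis using 1 by blast
  next
    case False
    then obtain xs ys zs y where p: "p = xs @ [y] @ ys @ [y] @ zs"
      using not_distinct_decomp by blast
    define p' where "p' = xs @ [y] @ zs"
    have "successively R p'" "p' \<noteq> []" "length p' < length p"
      using 1(2) unfolding p p'_def by (auto simp: successively_append_iff successively_Cons)
    then obtain q where "q \<noteq> [] \<and> distinct q \<and> successively R q \<and> set q \<subseteq> set p' \<and> hd q = hd p' \<and> last q = last p'"
      using 1(1) by blast
    moreover have "set p' \<subseteq> set p" "hd p' = hd p" "last p' = last p"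
      unfolding p p'_def by (auto simp: hd_append)
    ultimately show ?thesis by auto
  qed
qed

section \<open>Distances in a tree\<close>

locale tree_graph =
  fixes V :: "'v set" and adj :: "'v \<Rightarrow> 'v \<Rightarrow> bool"
  assumes is_tree: "is_tree V adj"
begin

abbreviation d :: "'v \<Rightarrow> 'v \<Rightarrow> nat" where "d \<equiv> graph_dist V adj"

abbreviation nbrs :: "'v \<Rightarrow> 'v set" where "nbrs \<equiv> graph_nbrs adj"

lemma adjD: "adj x y \<Longrightarrow> x \<in> V" "adj x y \<Longrightarrow> y \<in> V" "adj x y \<Longrightarrow> x \<noteq> y" "adj x y \<Longrightarrow> adj y x"
  using is_tree unfolding is_tree_def simple_graph_def by blast+

lemma nbrs_iff: "y \<in> nbrs x \<longleftrightarrow> adj x y"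
  by (simp add: graph_nbrs_def)

lemma dist_walk:
  assumes "x \<in> V" "y \<in> V"
  obtains p where "walk_betw V adj x p y" "length p = Suc (d x y)"
proof -
  obtain p where p: "walk_betw V adj x p y"
    using is_tree assms unfolding is_tree_def graph_connected_def by blast
  then have "\<exists>q. walk_betw V adj x q y \<and> length q = Suc (length p - 1)"
    by (intro exI[of _ p]) (auto simp: walk_betw_def)
  from LeastI[of "\<lambda>n. \<exists>q. walk_betw V adj x q y \<and> length q = Suc n", OF this] that
  show thesis unfolding graph_dist_def by blast
qed

lemma dist_le: "walk_betw V adj x p y \<Longrightarrow> d x y \<le> length p - 1"
  unfolding graph_dist_def by (rule Least_le) (auto simp: walk_betw_def)

lemma walk_rev: "walk_betw V adj x p y \<Longrightarrow> walk_betw V adj y (rev p) x"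
  unfolding walk_betw_def
  by (auto simp: hd_rev last_rev intro: successively_mono dest: adjD(4))

lemma walk_join:
  assumes "walk_betw V adj x p y" "walk_betw V adj y q z"
  shows "walk_betw V adj x (p @ tl q) z"
  using assms unfolding walk_betw_def
  by (cases q) (auto simp: successively_append_iff successively_Cons)

lemma dist_sym:
  assumes "x \<in> V" "y \<in> V" shows "d x y = d y x"
proof -
  have "d y x \<le> d x y" if "x \<in> V" "y \<in> V" for x y
    using dist_walk[OF that] walk_rev dist_le by (metis diff_Suc_1 length_rev)
  with assms show ?thesis by (simp add: le_antisym)
qed

lemma dist_triangle:
  assumes "x \<in> V" "y \<in> V" "z \<in> V" shows "d x z \<le> d x y + d y z"
proof -
  obtain p q where p: "walk_betw V adj x p y" "length p = Suc (d x y)"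
    and q: "walk_betw V adj y q z" "length q = Suc (d y z)"
    using dist_walk assms by metis
  have "d x z \<le> length (p @ tl q) - 1" using dist_le walk_join p q by blast
  then show ?thesis using p q by simp
qed

lemma dist_eq_0_iff:
  assumes "x \<in> V" "y \<in> V" shows "d x y = 0 \<longleftrightarrow> x = y"
proof
  assume 0: "d x y = 0"
  obtain p where "walk_betw V adj x p y" "length p = Suc (d x y)" using dist_walk assms by blast
  with 0 show "x = y" unfolding walk_betw_def by (cases p) auto
next
  assume "x = y"
  then have "walk_betw V adj x [x] y" using assms by (simp add: walk_betw_def)
  then show "d x y = 0" using dist_le by fastforce
qed

lemma dist_self [simp]: "x \<in> V \<Longrightarrow> d x x = 0"
  by (simp add: dist_eq_0_iff)

lemma dist_adj:
  assumes "adj x y" shows "d x y = 1"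
proof -
  have "walk_betw V adj x [x, y] y" using assms adjD by (auto simp: walk_betw_def)
  then have "d x y \<le> 1" using dist_le by fastforce
  moreover have "d x y \<noteq> 0" using dist_eq_0_iff adjD assms by blast
  ultimately show ?thesis by linarith
qed

lemma dist_adj_le:
  assumes "adj x z" "y \<in> V" shows "d x y \<le> Suc (d z y)"
  using dist_triangle[of x z y] dist_adj[OF assms(1)] adjD[OF assms(1)] assms by simp

lemma walk_first_step:
  assumes "walk_betw V adj x p y" "length p = Suc (Suc n)"
  obtains z p' where "adj x z" "walk_betw V adj z p' y" "length p' = Suc n" "p = x # p'"
proof -
  obtain z p'' where p: "p = x # z # p''"
    using assms unfolding walk_betw_def by (cases p; cases "tl p") auto
  show thesis
    by (rule that[of z "z # p''"]) (use assms p in \<open>auto simp: walk_betw_def\<close>)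
qed

lemma closer_nbr_exists:
  assumes "x \<in> V" "y \<in> V" "x \<noteq> y"
  obtains z where "adj x z" "d x y = Suc (d z y)"
proof -
  obtain p where p: "walk_betw V adj x p y" "length p = Suc (d x y)" using dist_walk assms by blast
  obtain n where n: "d x y = Suc n" using dist_eq_0_iff assms by (cases "d x y") auto
  obtain z p' where z: "adj x z" "walk_betw V adj z p' y" "length p' = Suc n"
    using walk_first_step p n by metis
  then have "d z y \<le> n" using dist_le by fastforce
  then show thesis using that z n dist_adj_le assms by (metis Suc_le_mono le_antisym)
qed

lemma geodesic_dist_less:
  assumes "walk_betw V adj x p y" "length p = Suc (d x y)" "z \<in> set p" "z \<noteq> x"
  shows "d z y < d x y"
proof -
  obtain p1 p2 where p: "p = p1 @ z # p2" using split_list assms(3) by metis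
  have "walk_betw V adj z (z # p2) y"
    using assms(1) unfolding p walk_betw_def by (auto simp: successively_append_iff)
  then have "d z y \<le> length p2" using dist_le by fastforce
  moreover have "p1 \<noteq> []" using p assms unfolding walk_betw_def by auto
  then have "length p2 < d x y" using assms(2) unfolding p by (cases p1) auto
  ultimately show ?thesis by simp
qed

text \<open>Geodesics from \<open>z1\<close> and \<open>z2\<close> to \<open>y\<close> miss
  \<open>x\<close>. Glued together and freed of repetitions, they would be closed to a cycle by
  \<open>x\<close>. Admitting equality of distances also excludes a neighbour as far from
  \<open>y\<close> as \<open>x\<close> is, next to the one that is closer.\<close>

lemma closer_nbr_unique:
  assumes x: "x \<in> V" and y: "y \<in> V" and 1: "adj x z1" "d z1 y \<le> d x y" and 2: "adj x z2" "d z2 y \<le> d x y"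
  shows "z1 = z2"
proof (rule ccontr)
  assume ne: "z1 \<noteq> z2"
  have avoid: "\<exists>p. walk_betw V adj z p y \<and> x \<notin> set p" if z: "adj x z" "d z y \<le> d x y" for z
  proof -
    obtain p where p: "walk_betw V adj z p y" "length p = Suc (d z y)"
      using dist_walk adjD z y by metis
    then show ?thesis using geodesic_dist_less[OF p, of x] adjD z by (metis not_le)
  qed
  obtain p1 p2 where p: "walk_betw V adj z1 p1 y" "x \<notin> set p1" "walk_betw V adj z2 p2 y" "x \<notin> set p2"
    using avoid 1 2 by meson
  define p where "p = p1 @ tl (rev p2)"
  have w: "walk_betw V adj z1 p z2" unfolding p_def using walk_join walk_rev p by blast
  have "x \<notin> set p" unfolding p_def using p by (metis Un_iff list.set_sel(2) set_append set_rev tl_Nil)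
  moreover obtain q where q: "q \<noteq> []" "distinct q" "successively adj q" "set q \<subseteq> set p" "hd q = z1" "last q = z2"
    using distinct_walk_exists[of adj p] w unfolding walk_betw_def by auto
  \<comment> \<open>As \<open>z1\<close> and \<open>z2\<close> differ, \<open>x # q\<close> has the
    three vertices that a cycle requires.\<close>
  moreover have "length q \<ge> 2"
    using q ne by (cases q; cases "tl q") auto
  moreover have "set p \<subseteq> V" using w unfolding walk_betw_def by blast
  ultimately have "graph_cycle V adj (x # q)"
    unfolding graph_cycle_def using x 1 2 adjD(4) by (auto simp: successively_Cons)
  then show False using is_tree unfolding is_tree_def by blast
qed

text \<open>A neighbour \<open>z\<close> that is not farther from \<open>y\<close> than
  \<open>x\<close> must be the first step of a geodesic from \<open>x\<close> to \<open>y\<close>,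
  so adjacent vertices are never equidistant from \<open>y\<close>.\<close>

lemma dist_nbr_cases:
  assumes "adj x z" "y \<in> V"
  shows "d x y = Suc (d z y) \<or> d z y = Suc (d x y)"
proof (cases "d z y \<le> d x y")
  case True
  then have "x \<noteq> y" using assms dist_self[of y] dist_eq_0_iff[of z y] adjD[OF assms(1)] by auto
  then obtain z' where "adj x z'" "d x y = Suc (d z' y)" using closer_nbr_exists assms adjD by metis
  then show ?thesis using closer_nbr_unique[of x y z z'] True assms adjD by fastforce
next
  case False
  then show ?thesis using dist_adj_le[of z x y] assms adjD by fastforce
qed

text \<open>A step of \<open>x\<close> towards \<open>y\<close> changes both \<open>d x y\<close>
  and \<open>d x z\<close> by one, so the parity of the sum is constant along the way. This is the
  bipartition in a symmetric form.\<close>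

lemma dist_parity:
  assumes "x \<in> V" "y \<in> V" "z \<in> V"
  shows "even (d x y + d y z + d x z)"
  using assms(1)
proof (induction "d x y" arbitrary: x)
  case 0
  then show ?case using assms dist_eq_0_iff by auto
next
  case (Suc n)
  then have "x \<noteq> y" using assms by auto
  then obtain x' where x': "adj x x'" "d x y = Suc (d x' y)" using closer_nbr_exists Suc assms by metis
  then have "even (d x' y + d y z + d x' z)" using Suc adjD by fastforce
  then show ?case using x' dist_nbr_cases[OF x'(1) assms(3)] by auto
qed

text \<open>The excluded \<open>u\<close> would be a first step common to the geodesics from
  \<open>p\<close> to \<open>x\<close> and from \<open>p\<close> to \<open>v\<close>. For the
  converse, \<open>p\<close> is moved towards \<open>x\<close>.\<close>

lemma dist_add_iff:
  assumes "x \<in> V" "p \<in> V" "v \<in> V"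
  shows "d x v = d x p + d p v \<longleftrightarrow> \<not> (\<exists>u. adj p u \<and> d u x < d p x \<and> d u v < d p v)"
proof
  assume eq: "d x v = d x p + d p v"
  show "\<not> (\<exists>u. adj p u \<and> d u x < d p x \<and> d u v < d p v)"
  proof
    assume "\<exists>u. adj p u \<and> d u x < d p x \<and> d u v < d p v"
    then obtain u where u: "adj p u" "d u x < d p x" "d u v < d p v" by blast
    then show False using dist_triangle[of x u v] adjD[OF u(1)] eq assms dist_sym[of x u] dist_sym[of x p] by simp
  qed
next
  assume "\<not> (\<exists>u. adj p u \<and> d u x < d p x \<and> d u v < d p v)"
  with assms(2) show "d x v = d x p + d p v"
  proof (induction "d x p" arbitrary: p)
    case 0
    then show ?case using assms dist_eq_0_iff by auto
  next
    case (Suc n)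
    have "p \<noteq> x" using Suc(2) assms by auto
    then obtain p' where p': "adj p p'" "d p x = Suc (d p' x)" using closer_nbr_exists Suc assms by metis
    have pv: "d p' v = Suc (d p v)"
      using Suc(4) p' dist_nbr_cases[OF p'(1) assms(3)] by auto
    have "p' \<in> V" using adjD p' by blast
    moreover have "n = d x p'" using p' Suc assms dist_sym adjD by (metis Suc_inject)
    moreover have "\<not> (\<exists>u. adj p' u \<and> d u x < d p' x \<and> d u v < d p' v)"
    proof
      assume "\<exists>u. adj p' u \<and> d u x < d p' x \<and> d u v < d p' v"
      then obtain u where u: "adj p' u" "d u x < d p' x" "d u v < d p' v" by blast
      \<comment> \<open>The step back to \<open>p\<close> is the only one from \<open>p'\<close>
        that approaches \<open>v\<close>, and it leads away from \<open>x\<close>; so the hypothesis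
        passes from \<open>p\<close> to \<open>p'\<close>.\<close>
      have "u = p"
        by (rule closer_nbr_unique[of p' v]) (use u p' pv assms adjD in auto)
      then show False using u p' by simp
    qed
    ultimately have "d x v = d x p' + d p' v" using Suc(1) by blast
    then show ?case using pv \<open>n = d x p'\<close> Suc(2) by simp
  qed
qed

section \<open>Geodesics, branches and intersections of two spheres\<close>

definition between :: "'v \<Rightarrow> 'v \<Rightarrow> 'v \<Rightarrow> bool" where
  "between x p y \<longleftrightarrow> p \<in> V \<and> d x y = d x p + d p y"

lemma between_exists:
  assumes "x \<in> V" "y \<in> V" "i + j = d x y"
  obtains p where "between x p y" "d x p = i" "d p y = j"
proof -
  have "\<exists>p. between x p y \<and> d x p = i \<and> d p y = j"
    using assms(3)
  proof (induction i arbitrary: j)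
    case 0
    then show ?case using assms by (intro exI[of _ x]) (auto simp: between_def)
  next
    case (Suc i)
    then obtain p where p: "between x p y" "d x p = i" "d p y = Suc j" by (metis add_Suc_shift)
    then have pV: "p \<in> V" unfolding between_def by blast
    have "p \<noteq> y" using p assms by auto
    then obtain p' where p': "adj p p'" "d p y = Suc (d p' y)" using closer_nbr_exists pV assms by metis
    have "p' \<in> V" using p' adjD by blast
    moreover have "d x p' \<le> Suc i" using dist_triangle[of x p p'] dist_adj[OF p'(1)] p pV assms \<open>p' \<in> V\<close> by simp
    moreover have "d x y \<le> d x p' + d p' y" using dist_triangle assms \<open>p' \<in> V\<close> by blast
    ultimately have "between x p' y \<and> d x p' = Suc i \<and> d p' y = j"
      unfolding between_def using p p' Suc by simp
    then show ?case by blast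
  qed
  then show thesis using that by blast
qed

text \<open>For adjacent \<open>p\<close> and \<open>u\<close>, these are the ends of the paths
  without backtracking that start with the edge from \<open>p\<close> to \<open>u\<close> and make
  \<open>l\<close> more steps.\<close>

definition branch :: "'v \<Rightarrow> 'v \<Rightarrow> nat \<Rightarrow> 'v set" where
  "branch p u l = {v \<in> V. d p v = Suc l \<and> d u v = l}"

lemma branch_0: "adj p u \<Longrightarrow> branch p u 0 = {u}"
  unfolding branch_def using dist_eq_0_iff adjD dist_adj by fastforce

lemma branch_Suc:
  assumes "adj p u"
  shows "branch p u (Suc l) = (\<Union>u'\<in>nbrs u - {p}. branch u u' l)"
proof (intro equalityI subsetI)
  fix v assume "v \<in> branch p u (Suc l)"
  then have v: "v \<in> V" "d p v = Suc (Suc l)" "d u v = Suc l" unfolding branch_def by auto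
  then have "u \<noteq> v" using dist_self by fastforce
  then obtain u' where u': "adj u u'" "d u v = Suc (d u' v)" using closer_nbr_exists v assms adjD by metis
  moreover have "u' \<in> nbrs u - {p}" using u' v by (auto simp: nbrs_iff)
  moreover have "v \<in> branch u u' l" using u' v unfolding branch_def by simp
  ultimately show "v \<in> (\<Union>u'\<in>nbrs u - {p}. branch u u' l)" by blast
next
  fix v assume "v \<in> (\<Union>u'\<in>nbrs u - {p}. branch u u' l)"
  then obtain u' where "u' \<in> nbrs u - {p}" "v \<in> branch u u' l" by blast
  then have u': "adj u u'" "u' \<noteq> p" and v: "v \<in> V" "d u v = Suc l" "d u' v = l"
    unfolding branch_def by (simp_all add: nbrs_iff)
  \<comment> \<open>The one neighbour of \<open>u\<close> that is not farther from \<open>v\<close>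
    is \<open>u'\<close>.\<close>
  have "\<not> d p v \<le> d u v"
    using closer_nbr_unique[of u v u' p] u' v assms adjD by fastforce
  then have "d p v = Suc (d u v)" using dist_nbr_cases[OF assms v(1)] by linarith
  then show "v \<in> branch p u (Suc l)" using v unfolding branch_def by simp
qed

lemma branch_disjoint:
  assumes "adj u u1" "adj u u2" "u1 \<noteq> u2"
  shows "branch u u1 l \<inter> branch u u2 l = {}"
  using closer_nbr_unique[of u _ u1 u2] assms adjD unfolding branch_def by fastforce

lemma card_branches:
  assumes "p \<in> V" "finite (nbrs p)" "W \<subseteq> nbrs p"
    and "\<And>u. u \<in> W \<Longrightarrow> finite (branch p u l) \<and> card (branch p u l) = c"
  shows "finite (\<Union>u\<in>W. branch p u l) \<and> card (\<Union>u\<in>W. branch p u l) = card W * c"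
proof -
  have fin: "finite W" using assms finite_subset by blast
  have "card (\<Union>u\<in>W. branch p u l) = (\<Sum>u\<in>W. card (branch p u l))"
    by (rule card_UN_disjoint)
      (use fin assms branch_disjoint in \<open>auto simp: nbrs_iff subset_iff\<close>)
  then show ?thesis using fin assms by simp
qed

text \<open>The vertices of \<open>U\<close> are the neighbours of \<open>p\<close> on the geodesic
  from \<open>x\<close> to \<open>y\<close>. Writing the radii as \<open>d x p + l\<close> and
  \<open>d y p + l\<close> forces \<open>v\<close> to hang off the geodesic at \<open>p\<close>, at
  depth \<open>l\<close>.\<close>

lemma sphere_intersection_eq:
  assumes V: "x \<in> V" "y \<in> V" and p: "between x p y"
  defines "U \<equiv> {u. adj p u \<and> (d u x < d p x \<or> d u y < d p y)}"
  shows "{v \<in> V. d x v = d x p + l \<and> d y v = d y p + l} =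
    (if l = 0 then {p} else (\<Union>u\<in>nbrs p - U. branch p u (l - 1)))"
proof -
  have pV: "p \<in> V" using p unfolding between_def by blast
  \<comment> \<open>If both equations failed, the first step from \<open>p\<close> to
    \<open>v\<close> would approach \<open>x\<close> as well as \<open>y\<close>, and the geodesic
    through \<open>p\<close> could be shortened.\<close>
  have add: "d x v = d x p + d p v \<or> d y v = d y p + d p v" if v: "v \<in> V" for v
  proof (rule ccontr)
    assume "\<not> ?thesis"
    then obtain u1 u2 where u: "adj p u1" "d u1 x < d p x" "d u1 v < d p v"
      "adj p u2" "d u2 y < d p y" "d u2 v < d p v"
      using dist_add_iff[OF V(1) pV v] dist_add_iff[OF V(2) pV v] by blast
    have "u1 = u2" using closer_nbr_unique[of p v u1 u2] u pV v by simp
    then show False using u p dist_triangle[of x u1 y] dist_sym V adjD[OF u(1)] pV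
      unfolding between_def by (metis add_less_le_mono less_imp_le not_le)
  qed
  \<comment> \<open>One of the equations in \<open>add\<close> turns the radii into
    \<open>d p v = l\<close>. Then both equations hold, and \<open>dist_add_iff\<close> translates
    them into the exclusion of \<open>U\<close>.\<close>
  have key: "d x v = d x p + l \<and> d y v = d y p + l \<longleftrightarrow> d p v = l \<and> \<not> (\<exists>u\<in>U. d u v < l)"
    if v: "v \<in> V" for v
  proof
    assume eq: "d x v = d x p + l \<and> d y v = d y p + l"
    then have "d p v = l" using add[OF v] by auto
    then show "d p v = l \<and> \<not> (\<exists>u\<in>U. d u v < l)"
      using eq dist_add_iff[OF V(1) pV v] dist_add_iff[OF V(2) pV v] unfolding U_def by auto
  next
    assume eq: "d p v = l \<and> \<not> (\<exists>u\<in>U. d u v < l)"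
    then show "d x v = d x p + l \<and> d y v = d y p + l"
      using dist_add_iff[OF V(1) pV v] dist_add_iff[OF V(2) pV v] unfolding U_def by auto
  qed
  show ?thesis
  proof (cases "l = 0")
    case True
    then show ?thesis using key pV dist_eq_0_iff by auto
  next
    case False
    have "(d p v = l \<and> \<not> (\<exists>u\<in>U. d u v < l)) \<longleftrightarrow> v \<in> (\<Union>u\<in>nbrs p - U. branch p u (l - 1))"
      if v: "v \<in> V" for v
    proof
      assume eq: "d p v = l \<and> \<not> (\<exists>u\<in>U. d u v < l)"
      then have "p \<noteq> v" using False pV by auto
      then obtain u where "adj p u" "d p v = Suc (d u v)" using closer_nbr_exists pV v by metis
      then show "v \<in> (\<Union>u\<in>nbrs p - U. branch p u (l - 1))"
        using eq v unfolding branch_def by (auto simp: nbrs_iff intro!: bexI[of _ u])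
    next
      assume "v \<in> (\<Union>u\<in>nbrs p - U. branch p u (l - 1))"
      then obtain u where u: "adj p u" "u \<notin> U" "d p v = l" "d u v = l - 1"
        unfolding branch_def using False by (auto simp: nbrs_iff)
      have "u' = u" if "u' \<in> U" "d u' v < l" for u'
        using closer_nbr_unique[of p v u' u] that u pV v unfolding U_def by auto
      then show "d p v = l \<and> \<not> (\<exists>u\<in>U. d u v < l)" using u by blast
    qed
    then have "{v \<in> V. d x v = d x p + l \<and> d y v = d y p + l} =
        {v \<in> V. v \<in> (\<Union>u\<in>nbrs p - U. branch p u (l - 1))}"
      using key by blast
    also have "\<dots> = (\<Union>u\<in>nbrs p - U. branch p u (l - 1))" unfolding branch_def by blast
    finally show ?thesis using False by simp
  qed
qed

text \<open>There is one step from \<open>p\<close> towards each end different from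
  \<open>p\<close>, and a step towards both ends would shorten the geodesic. The step missing at an
  end is the origin of the Kronecker delta.\<close>

lemma card_closer_nbrs:
  assumes V: "x \<in> V" "y \<in> V" and p: "between x p y"
  shows "card {u. adj p u \<and> (d u x < d p x \<or> d u y < d p y)} =
    of_bool (p \<noteq> x) + of_bool (p \<noteq> y)"
proof -
  have pV: "p \<in> V" using p unfolding between_def by blast
  have C: "card {u. adj p u \<and> d u z < d p z} = of_bool (p \<noteq> z) \<and> finite {u. adj p u \<and> d u z < d p z}"
    if z: "z \<in> V" for z
  proof (cases "p = z")
    case False
    then obtain u where u: "adj p u" "d p z = Suc (d u z)" using closer_nbr_exists pV z by metis
    have "{u. adj p u \<and> d u z < d p z} = {u}"
      using u closer_nbr_unique[of p z _ u] pV z by fastforce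
    then show ?thesis using False by simp
  qed (use z in auto)
  have "{u. adj p u \<and> d u x < d p x} \<inter> {u. adj p u \<and> d u y < d p y} = {}"
  proof (rule ccontr)
    assume "\<not> ?thesis"
    then obtain u where u: "adj p u" "d u x < d p x" "d u y < d p y" by blast
    then show False using p dist_triangle[of x u y] dist_sym V adjD[OF u(1)] pV
      unfolding between_def by (metis add_less_le_mono less_imp_le not_le)
  qed
  moreover have "{u. adj p u \<and> (d u x < d p x \<or> d u y < d p y)} =
     {u. adj p u \<and> d u x < d p x} \<union> {u. adj p u \<and> d u y < d p y}" by blast
  ultimately show ?thesis using C V by (simp add: card_Un_disjoint)
qed

text \<open>At most one neighbour of a vertex approaches \<open>x\<close> and at most one approaches
  \<open>y\<close>, so a third one leads away from both.\<close>

lemma extension_exists: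
  assumes V: "x \<in> V" "y \<in> V" "p \<in> V"
    and deg: "\<And>z. z \<in> V \<Longrightarrow> card (nbrs z) \<ge> 3"
  shows "\<exists>v\<in>V. d x v = d x p + n \<and> d y v = d y p + n"
proof (induction n)
  case (Suc n)
  then obtain v where v: "v \<in> V" "d x v = d x p + n" "d y v = d y p + n" by blast
  define C where "C z = {u. adj v u \<and> d u z < d v z}" for z
  have C: "finite (C z) \<and> card (C z) \<le> 1" if z: "z \<in> V" for z
  proof (cases "C z = {}")
    case False
    then obtain u where "u \<in> C z" by blast
    then have "C z = {u}"
      using closer_nbr_unique[of v z _ u] v z unfolding C_def by fastforce
    then show ?thesis by simp
  qed simp
  have "card (C x \<union> C y) \<le> 2"
    using card_Un_le[of "C x" "C y"] C[OF V(1)] C[OF V(2)] by linarith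
  then have "\<not> nbrs v \<subseteq> C x \<union> C y"
    using deg[OF v(1)] card_mono[of "C x \<union> C y" "nbrs v"] C[OF V(1)] C[OF V(2)] by auto
  then obtain u where u: "adj v u" "\<not> d u x < d v x" "\<not> d u y < d v y"
    unfolding C_def by (auto simp: nbrs_iff subset_iff)
  then have "d u x = Suc (d v x)" "d u y = Suc (d v y)"
    using dist_nbr_cases V by fastforce+
  then show ?case using v V dist_sym adjD(2)[OF u(1)] by (intro bexI[of _ u]) auto
qed (use V in auto)

end

section \<open>Counting in a tree whose degrees depend on parity\<close>

locale biregular_tree = tree_graph V adj
  for V :: "'v set" and adj :: "'v \<Rightarrow> 'v \<Rightarrow> bool" +
  fixes a :: 'v and q0 q1 :: nat
  assumes basepoint: "a \<in> V"
    and finite_nbrs: "x \<in> V \<Longrightarrow> finite (nbrs x)"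
    and degree_even: "x \<in> V \<Longrightarrow> even (d a x) \<Longrightarrow> card (nbrs x) = q0 + 1"
    and degree_odd: "x \<in> V \<Longrightarrow> odd (d a x) \<Longrightarrow> card (nbrs x) = q1 + 1"
begin

definition q :: "nat \<Rightarrow> nat" where "q l = (if even l then q0 else q1)"

text \<open>
  Below, degrees are read off from the distance \<open>l\<close> to the end of a path instead of the distance
  to \<open>a\<close>. This is legitimate if the end of the path is at even distance from \<open>a\<close>, or if
  \<open>q0 = q1\<close>.
\<close>

lemma degree:
  assumes "x \<in> V" "even (d a x + l) \<or> q0 = q1"
  shows "card (nbrs x) = Suc (q l)"
  using assms degree_even degree_odd unfolding q_def by (cases "even (d a x)") auto

lemma card_branch:
  assumes "adj p u" "even (d a u + l) \<or> q0 = q1"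
  shows "finite (branch p u l) \<and> card (branch p u l) = (\<Prod>i=1..l. q i)"
  using assms
proof (induction l arbitrary: p u)
  case 0
  then show ?case by (simp add: branch_0)
next
  case (Suc l)
  have uV: "u \<in> V" using adjD Suc by blast
  have "finite (\<Union>u'\<in>nbrs u - {p}. branch u u' l) \<and>
    card (\<Union>u'\<in>nbrs u - {p}. branch u u' l) = card (nbrs u - {p}) * (\<Prod>i=1..l. q i)"
  proof (rule card_branches)
    fix u' assume "u' \<in> nbrs u - {p}"
    then have u': "adj u u'" by (simp add: nbrs_iff)
    \<comment> \<open>A step flips the parity of the distance to \<open>a\<close> and lowers the
      number of remaining steps by one, so the condition is inherited.\<close>
    have "even (d a u' + l) \<or> q0 = q1"
      using Suc(3) dist_parity[of a u u'] dist_adj[OF u'] basepoint uV adjD[OF u'] by fastforce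
    with u' show "finite (branch u u' l) \<and> card (branch u u' l) = (\<Prod>i=1..l. q i)"
      by (rule Suc(1))
  qed (use uV finite_nbrs in auto)
  moreover have "card (nbrs u - {p}) = q (Suc l)"
    using degree[OF uV Suc(3)] adjD(4)[OF Suc(2)] by (simp add: nbrs_iff)
  ultimately show ?case using branch_Suc[OF Suc(2)] by (simp add: mult.commute)
qed

text \<open>
  The factor in front of the product is the number of neighbours, outside a geodesic, of a vertex
  of the geodesic at distances \<open>M - l\<close> and \<open>N - l\<close> from its ends; the truths of \<open>l = M\<close> and
  \<open>l = N\<close> tell whether this vertex is itself an end.
\<close>

definition intersection_number :: "nat \<Rightarrow> nat \<Rightarrow> nat \<Rightarrow> nat" where
  "intersection_number M N l =
     (if l = 0 then 1
      else (q l + of_bool (l = M) + of_bool (l = N) - 1) * (\<Prod>i=1..l - 1. q i))"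

text \<open>The first alternative of \<open>par\<close> says that the counted vertices lie at even
  distance from \<open>a\<close>. The branching point \<open>p\<close> exists because
  \<open>M - l\<close> and \<open>N - l\<close> add up to \<open>d x y\<close>.\<close>

lemma card_sphere_intersection:
  assumes V: "x \<in> V" "y \<in> V" and MN: "M + N = d x y + 2 * l" "l \<le> M" "l \<le> N"
    and par: "even (d a x + M) \<or> q0 = q1"
  shows "card {v \<in> V. d x v = M \<and> d y v = N} = intersection_number M N l"
proof -
  obtain p where p: "between x p y" "d x p = M - l" "d p y = N - l"
    using between_exists[OF V, of "M - l" "N - l"] MN by auto
  have pV: "p \<in> V" using p unfolding between_def by blast
  have yp: "d y p = N - l" using p dist_sym V pV by simp
  define U where "U = {u. adj p u \<and> (d u x < d p x \<or> d u y < d p y)}"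
  have eq: "{v \<in> V. d x v = M \<and> d y v = N} =
      (if l = 0 then {p} else (\<Union>u\<in>nbrs p - U. branch p u (l - 1)))"
    using sphere_intersection_eq[OF V p(1), of l] p(2) yp MN unfolding U_def by simp
  show ?thesis
  proof (cases "l = 0")
    case True
    then show ?thesis using eq by (simp add: intersection_number_def)
  next
    case False
    have par_p: "even (d a p + l) \<or> q0 = q1"
      using par dist_parity[of a x p] basepoint V pV p(2) MN by auto
    have "card (\<Union>u\<in>nbrs p - U. branch p u (l - 1)) = card (nbrs p - U) * (\<Prod>i=1..l - 1. q i)"
    proof (rule card_branches[THEN conjunct2])
      fix u assume "u \<in> nbrs p - U"
      then have u: "adj p u" by (simp add: nbrs_iff)
      have "even (d a u + (l - 1)) \<or> q0 = q1"
        using par_p dist_parity[of a p u] dist_adj[OF u] basepoint pV adjD[OF u] False by fastforce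
      with u show "finite (branch p u (l - 1)) \<and> card (branch p u (l - 1)) = (\<Prod>i=1..l - 1. q i)"
        by (rule card_branch)
    qed (use pV finite_nbrs in auto)
    \<comment> \<open>One neighbour is lost for each end other than \<open>p\<close>. This agrees
      with the factor in \<open>intersection_number\<close>, truncated subtraction included, even
      for \<open>q l = 0\<close>.\<close>
    moreover have "card (nbrs p - U) = Suc (q l) - (of_bool (l \<noteq> M) + of_bool (l \<noteq> N))"
    proof -
      have "U \<subseteq> nbrs p" unfolding U_def by (auto simp: nbrs_iff)
      then have "card (nbrs p - U) = card (nbrs p) - card U"
        using finite_nbrs[OF pV] by (simp add: card_Diff_subset finite_subset)
      moreover have "p = x \<longleftrightarrow> l = M" "p = y \<longleftrightarrow> l = N"
        using dist_eq_0_iff[OF V(1) pV] dist_eq_0_iff[OF V(2) pV] p(2) yp MN by auto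
      ultimately show ?thesis
        using card_closer_nbrs[OF V p(1)] degree[OF pV par_p] unfolding U_def by simp
    qed
    ultimately show ?thesis using eq False by (auto simp: intersection_number_def)
  qed
qed

end

section \<open>Actions transitive on spheres\<close>

locale tree_action = tree_graph V adj + group_action \<Gamma> V \<phi>
  for V :: "'v set" and adj :: "'v \<Rightarrow> 'v \<Rightarrow> bool" and \<Gamma> (structure) and \<phi> +
  fixes v0 :: 'v
  assumes base: "v0 \<in> V"
    and locally_finite: "x \<in> V \<Longrightarrow> finite (nbrs x)"
    and degree_ge_3: "x \<in> V \<Longrightarrow> card (nbrs x) \<ge> 3"
    and automorphism: "g \<in> carrier \<Gamma> \<Longrightarrow> graph_automorphism V adj (\<phi> g)"
    and proper: "stabilizer \<Gamma> \<phi> v0 \<noteq> carrier \<Gamma>"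
    and sphere_trans: "x \<in> V \<Longrightarrow> y \<in> V \<Longrightarrow> d v0 x = d v0 y \<Longrightarrow> \<exists>g\<in>stabilizer \<Gamma> \<phi> v0. \<phi> g x = y"
begin

sublocale group \<Gamma>
  using group_hom by (rule group_hom.axioms)

abbreviation H where "H \<equiv> stabilizer \<Gamma> \<phi> v0"

definition S where "S n = {g \<in> carrier \<Gamma>. d (\<phi> g v0) v0 = n}"

lemma H_carrier: "h \<in> H \<Longrightarrow> h \<in> carrier \<Gamma>"
  by (simp add: stabilizer_def)

lemma H_fixes: "h \<in> H \<Longrightarrow> \<phi> h v0 = v0"
  by (simp add: stabilizer_def)

lemma subgroup_H: "subgroup H \<Gamma>"
  using stabilizer_subgroup base .

lemma act_closed [simp]: "g \<in> carrier \<Gamma> \<Longrightarrow> x \<in> V \<Longrightarrow> \<phi> g x \<in> V"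
  using element_image by blast

lemma act_one [simp]: "x \<in> V \<Longrightarrow> \<phi> \<one> x = x"
  by (metis id_eq_one restrict_apply')

lemma act_inv_act [simp]: "g \<in> carrier \<Gamma> \<Longrightarrow> x \<in> V \<Longrightarrow> \<phi> (inv g) (\<phi> g x) = x"
  using orbit_sym_aux by blast

lemma act_act_inv [simp]: "g \<in> carrier \<Gamma> \<Longrightarrow> x \<in> V \<Longrightarrow> \<phi> g (\<phi> (inv g) x) = x"
  using act_inv_act[of "inv g"] by simp

lemma adj_act:
  assumes "g \<in> carrier \<Gamma>" "x \<in> V" "y \<in> V"
  shows "adj (\<phi> g x) (\<phi> g y) \<longleftrightarrow> adj x y"
  using automorphism assms unfolding graph_automorphism_def by blast

lemma dist_act:
  assumes "g \<in> carrier \<Gamma>" "x \<in> V" "y \<in> V"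
  shows "d (\<phi> g x) (\<phi> g y) = d x y"
proof -
  have le: "d (\<phi> g x) (\<phi> g y) \<le> d x y" if g: "g \<in> carrier \<Gamma>" and V: "x \<in> V" "y \<in> V" for g x y
  proof -
    obtain p where p: "walk_betw V adj x p y" "length p = Suc (d x y)" using dist_walk V by blast
    have "successively (\<lambda>u v. adj (\<phi> g u) (\<phi> g v)) p"
      using p(1) adj_act[OF g] unfolding walk_betw_def
      by (auto intro: successively_mono)
    then have "walk_betw V adj (\<phi> g x) (map (\<phi> g) p) (\<phi> g y)"
      using p(1) g unfolding walk_betw_def
      by (auto simp: successively_map hd_map last_map)
    then show ?thesis using dist_le p(2) by fastforce
  qed
  show ?thesis
    using le[OF assms] le[of "inv g" "\<phi> g x" "\<phi> g y"] assms by simp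
qed

lemma dist_inv_act:
  assumes "g \<in> carrier \<Gamma>" "x \<in> V" "y \<in> V"
  shows "d (\<phi> (inv g) x) y = d x (\<phi> g y)"
  using dist_act[of g "\<phi> (inv g) x" y] assms by simp

lemma card_nbrs_act:
  assumes "g \<in> carrier \<Gamma>" "x \<in> V"
  shows "card (nbrs (\<phi> g x)) = card (nbrs x)"
proof -
  have "nbrs (\<phi> g x) = \<phi> g ` nbrs x"
  proof (intro equalityI subsetI)
    fix y assume "y \<in> nbrs (\<phi> g x)"
    then have y: "adj (\<phi> g x) y" "y \<in> V" by (auto simp: nbrs_iff adjD)
    then have "adj x (\<phi> (inv g) y)" using adj_act[of g x "\<phi> (inv g) y"] assms by simp
    then show "y \<in> \<phi> g ` nbrs x" using y assms
      by (intro image_eqI[of _ _ "\<phi> (inv g) y"]) (auto simp: nbrs_iff)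
  qed (use assms adj_act adjD in \<open>auto simp: nbrs_iff\<close>)
  moreover have "inj_on (\<phi> g) (nbrs x)"
    using inj_prop[OF assms(1)] by (rule inj_on_subset) (auto simp: nbrs_iff adjD)
  ultimately show ?thesis by (simp add: card_image)
qed

lemma finite_sphere: "finite {v \<in> V. d v0 v = n}"
proof (induction n)
  case 0
  have "{v \<in> V. d v0 v = 0} \<subseteq> {v0}" using dist_eq_0_iff base by auto
  then show ?case by (rule finite_subset) simp
next
  case (Suc n)
  have "{v \<in> V. d v0 v = Suc n} \<subseteq> (\<Union>u\<in>{v \<in> V. d v0 v = n}. nbrs u)"
  proof
    fix v assume "v \<in> {v \<in> V. d v0 v = Suc n}"
    then have v: "v \<in> V" "d v0 v = Suc n" by auto
    then have "v \<noteq> v0" using base by auto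
    then obtain u where u: "adj v u" "d v v0 = Suc (d u v0)" using closer_nbr_exists v base by metis
    then have "u \<in> V" "adj u v" "d v0 u = n" using adjD v dist_sym base by auto
    then show "v \<in> (\<Union>u\<in>{v \<in> V. d v0 v = n}. nbrs u)" by (auto simp: nbrs_iff)
  qed
  then show ?case by (rule finite_subset) (use Suc locally_finite in auto)
qed

lemma sphere_nonempty: "\<exists>v\<in>V. d v0 v = n"
  using extension_exists[OF base base base degree_ge_3, of n] base by auto

text \<open>An orbit of \<open>v0\<close> that meets a sphere around \<open>v0\<close> contains it,
  by transitivity of the stabilizer.\<close>

lemma sphere_orbit:
  assumes "S n \<noteq> {}" "v \<in> V" "d v0 v = n"
  obtains g where "g \<in> S n" "\<phi> g v0 = v"
proof -
  obtain g where g: "g \<in> carrier \<Gamma>" "d (\<phi> g v0) v0 = n" using assms unfolding S_def by blast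
  then obtain h where h: "h \<in> H" "\<phi> h (\<phi> g v0) = v"
    using sphere_trans[of "\<phi> g v0" v] assms dist_sym base by auto
  then have "\<phi> (h \<otimes> g) v0 = v" using composition_rule H_carrier g base by simp
  moreover have "h \<otimes> g \<in> S n"
    using calculation h g H_carrier assms dist_sym base unfolding S_def by auto
  ultimately show thesis using that by blast
qed

section \<open>Distances realised by the orbit of the base vertex, and the orbits\<close>

definition K :: "nat set" where "K = {n. S n \<noteq> {}}"

lemma dist_in_K: "g \<in> carrier \<Gamma> \<Longrightarrow> d v0 (\<phi> g v0) \<in> K"
  unfolding K_def S_def using dist_sym base by auto

lemma zero_in_K: "0 \<in> K"
  using dist_in_K[of "\<one>"] base by simp

text \<open>Leave the geodesic from \<open>v0\<close> to \<open>w = g v0\<close> at distance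
  \<open>l\<close> before \<open>w\<close>, and go \<open>j - l\<close> steps away from both ends.
  The vertex reached is at distance \<open>j\<close> from \<open>w\<close>, so \<open>inv g\<close>
  moves it into a sphere contained in the orbit.\<close>

lemma K_closed:
  assumes "k \<in> K" "j \<in> K" "l \<le> k" "l \<le> j"
  shows "k + j - 2 * l \<in> K"
proof -
  obtain g where g: "g \<in> carrier \<Gamma>" "d v0 (\<phi> g v0) = k"
    using assms(1) dist_sym base unfolding K_def S_def by auto
  define w where "w = \<phi> g v0"
  have w: "w \<in> V" "d v0 w = (k - l) + l" using g base assms unfolding w_def by auto
  obtain p where p: "between v0 p w" "d v0 p = k - l" "d p w = l"
    using between_exists[OF base w(1)] w(2) by metis
  have pV: "p \<in> V" using p unfolding between_def by blast
  obtain v where v: "v \<in> V" "d v0 v = d v0 p + (j - l)" "d w v = d w p + (j - l)"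
    using extension_exists[OF base w(1) pV degree_ge_3, of "j - l"] by blast
  have "d v0 (\<phi> (inv g) v) = j"
    using v dist_inv_act[OF g(1) v(1) base] dist_sym w pV p base g assms unfolding w_def by simp
  then obtain h where "h \<in> S j" "\<phi> h v0 = \<phi> (inv g) v"
    using sphere_orbit[of j "\<phi> (inv g) v"] assms(2) g v unfolding K_def by auto
  then have "h \<in> carrier \<Gamma>" "\<phi> (g \<otimes> h) v0 = v"
    using composition_rule g base v unfolding S_def by auto
  then have "d v0 v \<in> K" using dist_in_K g by (metis m_closed)
  then show ?thesis using v p assms by (simp add: add.commute mult_2)
qed

lemma K_cases: "K = UNIV \<or> K = {n. even n}"
proof -
  obtain g where g: "g \<in> carrier \<Gamma>" "\<phi> g v0 \<noteq> v0"
    using proper H_carrier unfolding stabilizer_def by blast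
  define k where "k = d v0 (\<phi> g v0)"
  have k: "k \<in> K" "k > 0"
    using dist_in_K g base dist_eq_0_iff[of v0 "\<phi> g v0"] unfolding k_def by auto
  \<comment> \<open>Here \<open>k + k - 2 * (k - 1) = 2\<close>; properness of the stabilizer gave
    \<open>k > 0\<close>.\<close>
  have 2: "2 \<in> K" using K_closed[OF k(1) k(1), of "k - 1"] k(2) by (cases k) auto
  have even: "2 * n \<in> K" for n
  proof (induction n)
    case (Suc n)
    then show ?case using K_closed[OF Suc 2, of 0] by simp
  qed (simp add: zero_in_K)
  show ?thesis
  proof (cases "\<exists>j\<in>K. odd j")
    case True
    then obtain j i where j: "j \<in> K" "j = Suc (2 * i)" by (metis oddE Suc_eq_plus1)
    \<comment> \<open>Combining \<open>j = 2 * i + 1\<close> with \<open>2 * i\<close>, the choice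
      \<open>l = 2 * i\<close> leaves \<open>1\<close>.\<close>
    then have 1: "1 \<in> K" using K_closed[OF j(1) even[of i], of "2 * i"] by simp
    have "n \<in> K" for n
    proof (induction n)
      case (Suc n)
      then show ?case using K_closed[OF Suc 1, of 0] by simp
    qed (simp add: zero_in_K)
    then show ?thesis by blast
  next
    case False
    then show ?thesis using even by (auto elim!: evenE)
  qed
qed

lemma transitive_iff: "transitive_action \<Gamma> V \<phi> \<longleftrightarrow> K = UNIV"
proof
  assume t: "transitive_action \<Gamma> V \<phi>"
  show "K = UNIV"
  proof (intro equalityI subsetI)
    fix n :: nat
    obtain v where v: "v \<in> V" "d v0 v = n" using sphere_nonempty by blast
    then obtain g where "g \<in> carrier \<Gamma>" "\<phi> g v0 = v"
      using transitive_action.unique_orbit[OF t base v(1)] by blast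
    then show "n \<in> K" using dist_in_K v by blast
  qed auto
next
  assume K: "K = UNIV"
  have "\<exists>g\<in>carrier \<Gamma>. \<phi> g x = y" if "x \<in> V" "y \<in> V" for x y
  proof -
    have "\<exists>g\<in>carrier \<Gamma>. \<phi> g v0 = z" if "z \<in> V" for z
      using sphere_orbit[of "d v0 z" z] that K unfolding K_def S_def by blast
    then obtain g h where "g \<in> carrier \<Gamma>" "\<phi> g v0 = x" "h \<in> carrier \<Gamma>" "\<phi> h v0 = y"
      using \<open>x \<in> V\<close> \<open>y \<in> V\<close> by metis
    then show ?thesis using composition_rule[of x h "inv g"] that base
      by (intro bexI[of _ "h \<otimes> inv g"]) auto
  qed
  then show "transitive_action \<Gamma> V \<phi>"
    by (intro transitive_action.intro transitive_action_axioms.intro group_action_axioms) auto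
qed

text \<open>A vertex at odd distance has a neighbour in the orbit of \<open>v0\<close>. Moving this
  neighbour to \<open>v0\<close> brings the vertex to the sphere of radius 1, on which the
  stabilizer is transitive.\<close>

lemma same_parity_orbit:
  assumes "x \<in> V" "y \<in> V" "even (d v0 x) \<longleftrightarrow> even (d v0 y)"
  shows "\<exists>g\<in>carrier \<Gamma>. \<phi> g x = y"
proof -
  have even_orbit: "\<exists>g\<in>carrier \<Gamma>. \<phi> g v0 = z" if "z \<in> V" "even (d v0 z)" for z
    using sphere_orbit[of "d v0 z" z] that K_cases unfolding K_def S_def by blast
  have *: "\<exists>g\<in>carrier \<Gamma>. \<exists>u\<in>V. d v0 u = (if even (d v0 z) then 0 else 1) \<and> \<phi> g u = z" if z: "z \<in> V" for z
  proof (cases "even (d v0 z)")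
    case True
    then show ?thesis using even_orbit[OF z] base dist_self by metis
  next
    case False
    then have "z \<noteq> v0" using base by auto
    then obtain u where u: "adj z u" using closer_nbr_exists z base by metis
    then have uV: "u \<in> V" using adjD by blast
    then have "even (d v0 u)" using False dist_parity[OF base z uV] dist_adj[OF u] by simp
    then obtain g where g: "g \<in> carrier \<Gamma>" "\<phi> g v0 = u" using even_orbit uV by blast
    then have "d v0 (\<phi> (inv g) z) = 1"
      using dist_inv_act[OF g(1) z base] dist_adj[OF u] dist_sym base z by simp
    then show ?thesis using g z False
      by (intro bexI[of _ g] bexI[of _ "\<phi> (inv g) z"]) auto
  qed
  obtain g u h v where 1: "g \<in> carrier \<Gamma>" "u \<in> V" "\<phi> g u = x" "h \<in> carrier \<Gamma>" "v \<in> V" "\<phi> h v = y" "d v0 u = d v0 v"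
    using *[OF assms(1)] *[OF assms(2)] assms(3) by metis
  obtain k where k: "k \<in> H" "\<phi> k u = v" using sphere_trans 1 by meson
  have "\<phi> (h \<otimes> k \<otimes> inv g) x = y"
    using 1 k H_carrier[OF k(1)] by (auto simp: composition_rule)
  then show ?thesis using 1 H_carrier[OF k(1)] by blast
qed

lemma card_nbrs_parity:
  assumes "x \<in> V" "y \<in> V" "even (d v0 x) \<longleftrightarrow> even (d v0 y)"
  shows "card (nbrs x) = card (nbrs y)"
  using same_parity_orbit[OF assms] card_nbrs_act assms by metis

lemma orbits_two:
  assumes "K = {n. even n}"
  shows "card (orbits \<Gamma> V \<phi>) = 2"
proof -
  obtain v1 where v1: "v1 \<in> V" "d v0 v1 = 1" using sphere_nonempty by blast
  have v1': "v1 \<notin> orbit \<Gamma> \<phi> v0"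
    using dist_in_K v1 assms unfolding orbit_def by fastforce
  have in_orbit: "x \<in> orbit \<Gamma> \<phi> v0 \<or> x \<in> orbit \<Gamma> \<phi> v1" if "x \<in> V" for x
  proof -
    have "(\<exists>g\<in>carrier \<Gamma>. \<phi> g v0 = x) \<or> (\<exists>g\<in>carrier \<Gamma>. \<phi> g v1 = x)"
      using same_parity_orbit[of v0 x] same_parity_orbit[of v1 x] that base v1 by auto
    then show ?thesis unfolding orbit_def by blast
  qed
  have "orbits \<Gamma> V \<phi> = {orbit \<Gamma> \<phi> v0, orbit \<Gamma> \<phi> v1}"
  proof
    show "{orbit \<Gamma> \<phi> v0, orbit \<Gamma> \<phi> v1} \<subseteq> orbits \<Gamma> V \<phi>"
      using base v1 unfolding orbits_def by blast
    show "orbits \<Gamma> V \<phi> \<subseteq> {orbit \<Gamma> \<phi> v0, orbit \<Gamma> \<phi> v1}"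
    proof
      fix X assume X: "X \<in> orbits \<Gamma> V \<phi>"
      then obtain x where x: "x \<in> V" "X = orbit \<Gamma> \<phi> x" unfolding orbits_def by blast
      then have "x \<in> X" using orbit_refl by blast
      moreover have "orbit \<Gamma> \<phi> v0 \<in> orbits \<Gamma> V \<phi>" "orbit \<Gamma> \<phi> v1 \<in> orbits \<Gamma> V \<phi>"
        using base v1 unfolding orbits_def by blast+
      ultimately show "X \<in> {orbit \<Gamma> \<phi> v0, orbit \<Gamma> \<phi> v1}"
        using in_orbit[OF x(1)] disjoint_union[OF X] by blast
    qed
  qed
  moreover have "orbit \<Gamma> \<phi> v0 \<noteq> orbit \<Gamma> \<phi> v1" using v1' orbit_refl[OF v1(1)] by blast
  ultimately show ?thesis by simp
qed

section \<open>Cosets of the stabilizer and the structure constants\<close>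

lemma double_coset_eq:
  assumes "g \<in> carrier \<Gamma>"
  shows "double_coset \<Gamma> H g = S (d (\<phi> g v0) v0)"
proof (intro equalityI subsetI)
  fix x assume "x \<in> double_coset \<Gamma> H g"
  then obtain h h' where x: "h \<in> H" "h' \<in> H" "x = h \<otimes> g \<otimes> h'"
    unfolding double_coset_def r_coset_def set_mult_def by auto
  then have c: "h \<in> carrier \<Gamma>" "h' \<in> carrier \<Gamma>" using H_carrier by auto
  have "\<phi> x v0 = \<phi> h (\<phi> g v0)"
    using x c assms base H_fixes by (simp add: composition_rule)
  then have "d (\<phi> x v0) v0 = d (\<phi> g v0) v0"
    using dist_act[of h "\<phi> g v0" v0] c assms base H_fixes x by simp
  then show "x \<in> S (d (\<phi> g v0) v0)" using x c assms unfolding S_def by simp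
next
  fix x assume "x \<in> S (d (\<phi> g v0) v0)"
  then have x: "x \<in> carrier \<Gamma>" "d (\<phi> x v0) v0 = d (\<phi> g v0) v0" unfolding S_def by auto
  obtain h where h: "h \<in> H" "\<phi> h (\<phi> g v0) = \<phi> x v0"
    using sphere_trans[of "\<phi> g v0" "\<phi> x v0"] x assms base dist_sym by auto
  \<comment> \<open>Since \<open>h \<otimes> g\<close> and \<open>x\<close> send \<open>v0\<close>
    to the same vertex, this quotient fixes \<open>v0\<close>.\<close>
  define h' where "h' = inv (h \<otimes> g) \<otimes> x"
  have hc: "h \<in> carrier \<Gamma>" using h H_carrier by blast
  have "\<phi> h' v0 = v0"
    using act_inv_act[of "h \<otimes> g" v0] h hc x assms base unfolding h'_def
    by (simp add: composition_rule del: act_inv_act)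
  then have "h' \<in> H" using hc x assms unfolding h'_def stabilizer_def by simp
  moreover have "x = h \<otimes> g \<otimes> h'"
    unfolding h'_def using hc x assms by (simp flip: m_assoc)
  ultimately show "x \<in> double_coset \<Gamma> H g"
    using h unfolding double_coset_def r_coset_def set_mult_def by blast
qed

lemma double_cosets_eq: "double_cosets \<Gamma> H = S ` K"
proof -
  have "S n \<in> double_coset \<Gamma> H ` carrier \<Gamma>" if "n \<in> K" for n
    using that double_coset_eq unfolding K_def S_def by fastforce
  moreover have "double_coset \<Gamma> H g \<in> S ` K" if "g \<in> carrier \<Gamma>" for g
    using double_coset_eq[OF that] dist_in_K[OF that] dist_sym base that by auto
  ultimately show ?thesis unfolding double_cosets_def by blast
qed

text \<open>Right cosets force the inverse: \<open>inv (h \<otimes> g)\<close> and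
  \<open>inv g\<close> agree on \<open>v0\<close> for \<open>h \<in> H\<close>.\<close>

definition coset_vertex where "coset_vertex C = \<phi> (inv (coset_rep C)) v0"

lemma coset_vertex_eq:
  assumes "C \<in> rcosets H" "g \<in> C"
  shows "coset_vertex C = \<phi> (inv g) v0"
  unfolding coset_vertex_def coset_rep_def using orbit_stab_fun_is_well_defined1[OF base assms] .

lemma coset_vertex_inj: "inj_on coset_vertex (rcosets H)"
  unfolding inj_on_def coset_vertex_def coset_rep_def using orbit_stab_fun_is_inj[OF base] by blast

lemma rcoset_subset_carrier: "C \<in> rcosets H \<Longrightarrow> C \<subseteq> carrier \<Gamma>"
  using subgroup.rcosets_carrier[OF subgroup_H is_group] .

lemma coset_rep_in: "C \<in> rcosets H \<Longrightarrow> coset_rep C \<in> C"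
  unfolding coset_rep_def using stab_rcosets_not_empty[OF base] by (simp add: some_in_eq)

lemma coset_rep_carrier: "C \<in> rcosets H \<Longrightarrow> coset_rep C \<in> carrier \<Gamma>"
  using coset_rep_in rcoset_subset_carrier by blast

lemma rcoset_mem: "g \<in> carrier \<Gamma> \<Longrightarrow> H #> g \<in> rcosets H \<and> g \<in> H #> g"
  using rcosetsI[OF stabilizer_subset] rcos_self subgroup_H by blast

lemma rcoset_mem_iff:
  assumes "x \<in> carrier \<Gamma>" "y \<in> carrier \<Gamma>"
  shows "y \<in> H #> x \<longleftrightarrow> \<phi> (inv y) v0 = \<phi> (inv x) v0"
proof
  assume "y \<in> H #> x"
  then show "\<phi> (inv y) v0 = \<phi> (inv x) v0"
    using coset_vertex_eq rcoset_mem assms by metis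
next
  assume "\<phi> (inv y) v0 = \<phi> (inv x) v0"
  then have "coset_vertex (H #> y) = coset_vertex (H #> x)"
    using coset_vertex_eq rcoset_mem assms by metis
  then have "H #> y = H #> x" using coset_vertex_inj rcoset_mem assms unfolding inj_on_def by blast
  then show "y \<in> H #> x" using rcoset_mem assms by blast
qed

lemma right_cosets_in_eq:
  "right_cosets_in \<Gamma> H (S n) = {C \<in> rcosets H. d v0 (coset_vertex C) = n}"
proof -
  have *: "C \<subseteq> S n \<longleftrightarrow> d v0 (coset_vertex C) = n" if C: "C \<in> rcosets H" for C
  proof -
    have dist: "d (\<phi> g v0) v0 = d v0 (coset_vertex C)" if g: "g \<in> C" for g
    proof -
      have "g \<in> carrier \<Gamma>" using g C rcoset_subset_carrier by blast
      then show ?thesis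
        using coset_vertex_eq[OF C g] dist_inv_act[of g v0 v0] dist_sym base by simp
    qed
    have "g \<in> S n \<longleftrightarrow> d v0 (coset_vertex C) = n" if "g \<in> C" for g
      using dist[OF that] rcoset_subset_carrier[OF C] that unfolding S_def by auto
    then show ?thesis using coset_rep_in[OF C] by blast
  qed
  then show ?thesis unfolding right_cosets_in_def by blast
qed

text \<open>The right cosets in \<open>S n\<close> inject into the sphere of radius
  \<open>n\<close>, which is finite.\<close>

lemma hecke_pair_stabilizer: "hecke_pair \<Gamma> H"
proof -
  have "\<exists>F. finite F \<and> F \<subseteq> rcosets H \<and> D = \<Union> F" if D: "D \<in> double_cosets \<Gamma> H" for D
  proof -
    obtain n where n: "D = S n" using D double_cosets_eq by blast
    have "coset_vertex ` right_cosets_in \<Gamma> H (S n) \<subseteq> {v \<in> V. d v0 v = n}"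
      unfolding right_cosets_in_eq coset_vertex_def using coset_rep_carrier base by auto
    moreover have "inj_on coset_vertex (right_cosets_in \<Gamma> H (S n))"
      using coset_vertex_inj by (rule inj_on_subset) (auto simp: right_cosets_in_def)
    ultimately have "finite (right_cosets_in \<Gamma> H (S n))"
      using finite_sphere finite_imageD finite_subset by metis
    moreover have "S n = \<Union> (right_cosets_in \<Gamma> H (S n))"
    proof (intro equalityI subsetI)
      fix g assume g: "g \<in> S n"
      then have "g \<in> carrier \<Gamma>" "d (\<phi> g v0) v0 = n" unfolding S_def by auto
      then have "H #> g \<in> right_cosets_in \<Gamma> H (S n)" "g \<in> H #> g"
        unfolding right_cosets_in_eq
        using rcoset_mem coset_vertex_eq[of "H #> g" g] dist_inv_act[of g v0 v0] dist_sym base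
        by auto
      then show "g \<in> \<Union> (right_cosets_in \<Gamma> H (S n))" by blast
    qed (auto simp: right_cosets_in_def)
    ultimately show ?thesis using n unfolding right_cosets_in_def by blast
  qed
  then show ?thesis using is_group subgroup_H unfolding hecke_pair_def by blast
qed

text \<open>A pair is determined by its second coset, whose vertex is the counted \<open>v\<close>.
  By \<open>M \<in> K\<close> each such \<open>v\<close> is the vertex of a coset \<open>C'\<close>;
  its partner is the coset of \<open>x \<otimes> inv (coset_rep C')\<close>.\<close>

lemma hecke_coeff_eq:
  assumes "x \<in> carrier \<Gamma>" "M \<in> K"
  shows "hecke_coeff \<Gamma> H (S N) (S M) x = card {v \<in> V. d v0 v = M \<and> d (\<phi> (inv x) v0) v = N}"
proof -
  let ?P = "{(C, C'). C \<in> right_cosets_in \<Gamma> H (S N) \<and> C' \<in> right_cosets_in \<Gamma> H (S M) \<and>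
                    coset_rep C \<otimes> coset_rep C' \<in> H #> x}"
  let ?w = "\<phi> (inv x) v0"
  have wV: "?w \<in> V" using assms base by simp
  have prod_iff: "coset_rep C \<otimes> coset_rep C' \<in> H #> x \<longleftrightarrow> coset_vertex C = \<phi> (coset_rep C') ?w"
    if C: "C \<in> rcosets H" "C' \<in> rcosets H" for C C'
  proof -
    have c: "coset_rep C \<in> carrier \<Gamma>" "coset_rep C' \<in> carrier \<Gamma>" using C coset_rep_carrier by auto
    then have "coset_rep C \<otimes> coset_rep C' \<in> H #> x \<longleftrightarrow> \<phi> (inv (coset_rep C')) (coset_vertex C) = ?w"
      using rcoset_mem_iff assms base
      by (simp add: inv_mult_group composition_rule coset_vertex_def)
    also have "\<dots> \<longleftrightarrow> coset_vertex C = \<phi> (coset_rep C') ?w"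
      using c base wV unfolding coset_vertex_def by (metis act_act_inv act_closed act_inv_act inv_closed)
    finally show ?thesis .
  qed
  have "bij_betw (\<lambda>(C, C'). coset_vertex C') ?P {v \<in> V. d v0 v = M \<and> d ?w v = N}"
  proof (rule bij_betwI')
    fix X Y assume "X \<in> ?P" "Y \<in> ?P"
    then obtain C C' D D' where X: "X = (C, C')" "C \<in> rcosets H" "C' \<in> rcosets H" "coset_rep C \<otimes> coset_rep C' \<in> H #> x"
      and Y: "Y = (D, D')" "D \<in> rcosets H" "D' \<in> rcosets H" "coset_rep D \<otimes> coset_rep D' \<in> H #> x"
      unfolding right_cosets_in_def by auto
    have "C = D \<and> C' = D'" if eq: "coset_vertex C' = coset_vertex D'"
    proof -
      have "C' = D'" using inj_onD[OF coset_vertex_inj eq] X Y by blast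
      then have "coset_vertex C = coset_vertex D"
        using prod_iff[OF X(2,3)] prod_iff[OF Y(2,3)] X(4) Y(4) by simp
      then show ?thesis using inj_onD[OF coset_vertex_inj] X Y \<open>C' = D'\<close> by blast
    qed
    then show "((case X of (C, C') \<Rightarrow> coset_vertex C') = (case Y of (C, C') \<Rightarrow> coset_vertex C')) = (X = Y)"
      using X(1) Y(1) by auto
  next
    fix X assume "X \<in> ?P"
    then obtain C C' where X: "X = (C, C')" "C \<in> rcosets H" "C' \<in> rcosets H"
       "d v0 (coset_vertex C) = N" "d v0 (coset_vertex C') = M" "coset_vertex C = \<phi> (coset_rep C') ?w"
      unfolding right_cosets_in_eq using prod_iff by auto
    have c: "coset_rep C' \<in> carrier \<Gamma>" using X coset_rep_carrier by auto
    have "coset_vertex C' \<in> V" using c base unfolding coset_vertex_def by auto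
    moreover have "d ?w (coset_vertex C') = N"
      using dist_inv_act[OF c base wV] X dist_sym[OF wV calculation] unfolding coset_vertex_def by simp
    ultimately show "(case X of (C, C') \<Rightarrow> coset_vertex C') \<in> {v \<in> V. d v0 v = M \<and> d ?w v = N}"
      using X by auto
  next
    fix v assume "v \<in> {v \<in> V. d v0 v = M \<and> d ?w v = N}"
    then have v: "v \<in> V" "d v0 v = M" "d ?w v = N" by auto
    obtain g where g: "g \<in> carrier \<Gamma>" "\<phi> g v0 = v"
      using sphere_orbit[of M v] v assms unfolding K_def S_def by blast
    define C' where "C' = H #> inv g"
    have C': "C' \<in> rcosets H" "coset_vertex C' = v"
      using rcoset_mem[of "inv g"] coset_vertex_eq[of C' "inv g"] g unfolding C'_def by auto
    have c: "coset_rep C' \<in> carrier \<Gamma>" using C' coset_rep_carrier by auto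
    define C where "C = H #> (x \<otimes> inv (coset_rep C'))"
    have C: "C \<in> rcosets H" "coset_vertex C = \<phi> (coset_rep C') ?w"
      using rcoset_mem[of "x \<otimes> inv (coset_rep C')"] coset_vertex_eq[of C "x \<otimes> inv (coset_rep C')"]
        c assms base unfolding C_def by (auto simp: inv_mult_group composition_rule)
    have "d v0 (coset_vertex C) = N"
      using dist_inv_act[OF c base wV] C C' v dist_sym[OF wV v(1)] unfolding coset_vertex_def by simp
    then have "(C, C') \<in> ?P" using C C' v prod_iff unfolding right_cosets_in_eq by auto
    then show "\<exists>X\<in>?P. v = (case X of (C, C') \<Rightarrow> coset_vertex C')" using C' by (intro bexI) auto
  qed
  then show ?thesis unfolding hecke_coeff_def by (rule bij_betw_same_card)
qed

end

section \<open>The multiplication table\<close>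

lemma lookup_hecke_scale: "Poly_Mapping.lookup (c *\<^sub>H f) k = c * Poly_Mapping.lookup f k"
  unfolding hecke_scale_def by (simp add: Poly_Mapping.map.rep_eq when_def)

lemma hecke_scale_one [simp]: "1 *\<^sub>H f = f"
  by (rule poly_mapping_eqI) (simp add: lookup_hecke_scale)

lemma hecke_scale_zero [simp]: "0 *\<^sub>H f = 0"
  by (rule poly_mapping_eqI) (simp add: lookup_hecke_scale)

lemma hecke_scale_scale: "a *\<^sub>H b *\<^sub>H f = (a * b) *\<^sub>H f"
  by (rule poly_mapping_eqI) (simp add: lookup_hecke_scale mult.assoc)

lemma hecke_scale_sum: "c *\<^sub>H sum f A = (\<Sum>i\<in>A. c *\<^sub>H f i)"
  by (rule poly_mapping_eqI) (simp add: lookup_hecke_scale lookup_sum sum_distrib_left)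

lemma hecke_mult_basis:
  "hecke_mult G H (hecke_basis D) (hecke_basis D') = hecke_basis_mult G H D D'"
  unfolding hecke_mult_def by (simp add: hecke_basis_def)

locale biregular_tree_action =
  tree_action V adj \<Gamma> \<phi> v0 + biregular_tree V adj v0 q0 q1
  for V :: "'v set" and adj :: "'v \<Rightarrow> 'v \<Rightarrow> bool" and \<Gamma> (structure) and \<phi>
    and v0 :: 'v and q0 q1 :: nat
begin

text \<open>Spheres are nonempty, so \<open>q l + 1\<close> is the degree of an actual vertex. The
  bound lets the subtraction \<open>q l - 1\<close> of naturals pass to the coefficient
  ring.\<close>

lemma q_ge_2: "q l \<ge> 2"
proof -
  obtain v where v: "v \<in> V" "d v0 v = l" using sphere_nonempty by blast
  then show ?thesis using degree[of v l] degree_ge_3[OF v(1)] by simp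
qed

lemma intersection_number_commute: "intersection_number M N l = intersection_number N M l"
  unfolding intersection_number_def by (simp add: add.commute add.left_commute)

text \<open>A counted vertex would yield \<open>l = (M + N - k) / 2\<close>: parity and
  \<open>k \<le> M + N\<close> make it a natural number, and the other two triangle inequalities say
  \<open>l \<le> M\<close> and \<open>l \<le> N\<close>.\<close>

lemma hecke_coeff_zero:
  assumes x: "x \<in> carrier \<Gamma>" "d (\<phi> x v0) v0 = k" and M: "M \<in> K"
    and no: "\<And>l. l \<le> M \<Longrightarrow> l \<le> N \<Longrightarrow> M + N \<noteq> k + 2 * l"
  shows "hecke_coeff \<Gamma> H (S N) (S M) x = 0"
proof -
  let ?w = "\<phi> (inv x) v0"
  have w: "?w \<in> V" "d v0 ?w = k"
    using x base dist_inv_act[of x v0 v0] dist_sym by auto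
  have "{v \<in> V. d v0 v = M \<and> d ?w v = N} = {}"
  proof (rule ccontr)
    assume "\<not> ?thesis"
    then obtain v where v: "v \<in> V" "d v0 v = M" "d ?w v = N" by blast
    have "even (k + N + M)" using dist_parity[OF base w(1) v(1)] w v by simp
    moreover have "k \<le> M + N" "M \<le> k + N" "N \<le> k + M"
      using dist_triangle[OF base v(1) w(1)] dist_triangle[OF base w(1) v(1)]
        dist_triangle[OF w(1) base v(1)] w v dist_sym base by auto
    ultimately have "even (M + N - k)" by (simp add: ac_simps)
    then obtain l where "M + N - k = 2 * l" by (elim evenE)
    then show False using no[of l] \<open>k \<le> M + N\<close> \<open>M \<le> k + N\<close> \<open>N \<le> k + M\<close> by linarith
  qed
  then show ?thesis using hecke_coeff_eq[OF x(1) M] by (simp only: card.empty)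
qed

lemma hecke_coeff_intersection:
  assumes x: "x \<in> carrier \<Gamma>" "d (\<phi> x v0) v0 = k" and M: "M \<in> K"
    and "M + N = k + 2 * l" "l \<le> M" "l \<le> N" and "even M \<or> q0 = q1"
  shows "hecke_coeff \<Gamma> H (S N) (S M) x = intersection_number M N l"
proof -
  have "\<phi> (inv x) v0 \<in> V" "d v0 (\<phi> (inv x) v0) = k"
    using x base dist_inv_act[of x v0 v0] dist_sym by auto
  then show ?thesis
    using hecke_coeff_eq[OF x(1) M] card_sphere_intersection[OF base, of "\<phi> (inv x) v0" M N l] assms base
    by simp
qed

lemma S_inj: "inj_on S K"
  unfolding inj_on_def K_def S_def by blast

text \<open>Each double coset with nonzero coefficient is \<open>f l\<close> for exactly one
  \<open>l\<close>, and extending the defining sum to all \<open>f l\<close> can only add zero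
  terms.\<close>

lemma hecke_basis_mult_S:
  assumes K: "M \<in> K" "N \<in> K" and par: "even M \<or> q0 = q1"
  shows "hecke_basis_mult \<Gamma> H (S N) (S M) =
    (\<Sum>l\<le>min M N. of_nat (intersection_number M N l) *\<^sub>H
      (hecke_basis (S (M + N - 2 * l)) :: 'a set \<Rightarrow>\<^sub>0 'r::comm_ring_1))"
proof -
  define I where "I = {..min M N}"
  define f where "f l = S (M + N - 2 * l)" for l
  let ?c = "\<lambda>X. hecke_coeff \<Gamma> H (S N) (S M) (coset_rep X)"
  have fK: "M + N - 2 * l \<in> K" if "l \<in> I" for l
    using K_closed[OF K] that unfolding I_def by simp
  have rep: "coset_rep (S k) \<in> carrier \<Gamma> \<and> d (\<phi> (coset_rep (S k)) v0) v0 = k" if "k \<in> K" for k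
  proof -
    have "coset_rep (S k) \<in> S k" using that unfolding K_def coset_rep_def by (simp add: some_in_eq)
    then show ?thesis unfolding S_def by simp
  qed
  have inj: "inj_on f I"
  proof (rule inj_onI)
    fix i j assume ij: "i \<in> I" "j \<in> I" "f i = f j"
    then have "M + N - 2 * i = M + N - 2 * j" using inj_onD[OF S_inj] fK unfolding f_def by blast
    moreover have "i \<le> M" "i \<le> N" "j \<le> M" "j \<le> N" using ij unfolding I_def by auto
    ultimately show "i = j" by linarith
  qed
  have "hecke_basis_mult \<Gamma> H (S N) (S M) =
    (\<Sum>X\<in>f ` I. of_nat (?c X) *\<^sub>H (hecke_basis X :: 'a set \<Rightarrow>\<^sub>0 'r))"
    unfolding hecke_basis_mult_def
  proof (rule sum.mono_neutral_left)
    show "{X \<in> double_cosets \<Gamma> H. ?c X \<noteq> 0} \<subseteq> f ` I"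
    proof
      fix X assume "X \<in> {X \<in> double_cosets \<Gamma> H. ?c X \<noteq> 0}"
      then have "X \<in> S ` K" "?c X \<noteq> 0" unfolding double_cosets_eq by simp_all
      then obtain k where k: "k \<in> K" "X = S k" "?c (S k) \<noteq> 0" by (elim imageE) simp
      obtain l where l: "l \<le> M" "l \<le> N" "M + N = k + 2 * l"
        using hecke_coeff_zero[of "coset_rep (S k)" k M N] rep[OF k(1)] K(1) k(3) by blast
      then have "M + N - 2 * l = k" by simp
      then show "X \<in> f ` I" using k(2) l unfolding f_def I_def
        by (intro image_eqI[of _ _ l]) auto
    qed
    show "\<forall>X\<in>f ` I - {X \<in> double_cosets \<Gamma> H. ?c X \<noteq> 0}.
        of_nat (?c X) *\<^sub>H (hecke_basis X :: 'a set \<Rightarrow>\<^sub>0 'r) = 0"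
    proof
      fix X assume X: "X \<in> f ` I - {X \<in> double_cosets \<Gamma> H. ?c X \<noteq> 0}"
      then have "X \<in> double_cosets \<Gamma> H" using fK unfolding double_cosets_eq f_def by blast
      then have "?c X = 0" using X by blast
      then show "of_nat (?c X) *\<^sub>H (hecke_basis X :: 'a set \<Rightarrow>\<^sub>0 'r) = 0" by simp
    qed
  qed (simp add: I_def)
  also have "\<dots> = (\<Sum>l\<in>I. of_nat (?c (f l)) *\<^sub>H hecke_basis (f l))"
    using sum.reindex[OF inj] by simp
  also have "\<dots> = (\<Sum>l\<in>I. of_nat (intersection_number M N l) *\<^sub>H hecke_basis (f l))"
  proof (rule sum.cong)
    fix l assume l: "l \<in> I"
    have "?c (f l) = intersection_number M N l"
      unfolding f_def
      by (rule hecke_coeff_intersection[where k = "M + N - 2 * l"])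
        (use rep[OF fK[OF l]] K par l in \<open>auto simp: I_def\<close>)
    then show "of_nat (?c (f l)) *\<^sub>H hecke_basis (f l) = of_nat (intersection_number M N l) *\<^sub>H hecke_basis (f l)"
      by simp
  qed simp
  finally show ?thesis unfolding I_def f_def .
qed

text \<open>The intersection number is symmetric in \<open>M\<close> and \<open>N\<close>. The
  parity condition of \<open>hecke_basis_mult_S\<close> concerns the second factor, so here it is
  imposed on both.\<close>

lemma hecke_mult_commute:
  assumes "M \<in> K" "N \<in> K" "even M \<and> even N \<or> q0 = q1"
  shows "hecke_mult \<Gamma> H (hecke_basis (S N)) (hecke_basis (S M)) =
    (hecke_mult \<Gamma> H (hecke_basis (S M)) (hecke_basis (S N)) :: 'a set \<Rightarrow>\<^sub>0 'r::comm_ring_1)"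
  using hecke_basis_mult_S[of M N, where 'r = 'r] hecke_basis_mult_S[of N M, where 'r = 'r] assms
  by (auto simp: hecke_mult_basis intersection_number_commute[of N M] add.commute min.commute)

lemma hecke_mult_S:
  fixes T :: "nat \<Rightarrow> ('a set \<Rightarrow>\<^sub>0 'r::comm_ring_1)"
  assumes "M \<in> K" "N \<in> K" "even M \<and> even N \<or> q0 = q1" and MN: "N \<le> M" "0 < N"
  defines "T \<equiv> \<lambda>n. hecke_basis (S n)"
  shows "hecke_mult \<Gamma> H (T M) (T N) = T (M + N)
    + ((of_nat (q N) + (if M = N then 1 else 0)) * (\<Prod>i=1..N - 1. of_nat (q i))) *\<^sub>H T (M - N)
    + (\<Sum>l=1..N - 1. ((of_nat (q l) - 1) * (\<Prod>i=1..l - 1. of_nat (q i))) *\<^sub>H T (M + N - 2 * l))"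
proof -
  let ?g = "\<lambda>l. of_nat (intersection_number M N l) *\<^sub>H T (M + N - 2 * l)"
  have "hecke_mult \<Gamma> H (T M) (T N) = sum ?g {..N}"
    using hecke_mult_commute[OF assms(1-3), where 'r = 'r] hecke_basis_mult_S[of M N, where 'r = 'r] assms
    by (auto simp: hecke_mult_basis min_absorb2)
  also have "{..N} = insert 0 (insert N {1..N - 1})" using MN by auto
  also have "sum ?g \<dots> = ?g 0 + (?g N + sum ?g {1..N - 1})" using MN by simp
  also have "?g 0 = T (M + N)" by (simp add: intersection_number_def)
  \<comment> \<open>At \<open>l = N\<close> the truth of \<open>l = N\<close> cancels the
    \<open>- 1\<close>, and that of \<open>l = M\<close> survives as the Kronecker delta.\<close>
  also have "?g N = ((of_nat (q N) + (if M = N then 1 else 0)) * (\<Prod>i=1..N - 1. of_nat (q i))) *\<^sub>H T (M - N)"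
    using MN by (auto simp: intersection_number_def)
  also have "sum ?g {1..N - 1} =
    (\<Sum>l=1..N - 1. ((of_nat (q l) - 1) * (\<Prod>i=1..l - 1. of_nat (q i))) *\<^sub>H T (M + N - 2 * l))"
  proof (rule sum.cong)
    fix l assume l: "l \<in> {1..N - 1}"
    \<comment> \<open>For \<open>0 < l < N \<le> M\<close> the branching point is not an end of the
      geodesic, so the factor is \<open>q l - 1\<close>.\<close>
    have "of_nat (q l - 1) = (of_nat (q l) - 1 :: 'r)"
      using q_ge_2[of l] by (simp add: of_nat_diff)
    then show "?g l = ((of_nat (q l) - 1) * (\<Prod>i=1..l - 1. of_nat (q i))) *\<^sub>H T (M + N - 2 * l)"
      using l MN by (auto simp: intersection_number_def)
  qed simp
  finally show ?thesis by (simp add: add.assoc)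
qed

text \<open>With \<open>n - 1\<close> for \<open>n\<close> this is the factor
  \<open>q1 ^ n * q0 ^ (n - 1)\<close> of the table for two orbits.\<close>

lemma prod_q_odd: "(\<Prod>i=1..2 * n + 1. of_nat (q i)) = (of_nat q1 ^ (n + 1) * of_nat q0 ^ n :: 'r::comm_semiring_1)"
proof (induction n)
  case (Suc n)
  have "2 * Suc n + 1 = Suc (Suc (2 * n + 1))" by simp
  then show ?case using Suc by (simp add: q_def mult_ac)
qed (simp add: q_def)

end

theorem corollary3p5:
  fixes V :: "'v set" and adj :: "'v \<Rightarrow> 'v \<Rightarrow> bool" and v0 :: 'v
    and \<Gamma> :: "('g, 'm) monoid_scheme" and \<phi> :: "'g \<Rightarrow> 'v \<Rightarrow> 'v"
    and \<Gamma>0 :: "'g set" and S :: "nat \<Rightarrow> 'g set" and T :: "nat \<Rightarrow> ('g set \<Rightarrow>\<^sub>0 complex)"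
  assumes tree: "is_tree V adj"
    and lf: "locally_finite_graph V adj"
    and deg3: "\<forall>x\<in>V. graph_degree adj x \<ge> 3"
    and v0: "v0 \<in> V"
    and act: "group_action \<Gamma> V \<phi>"
    and aut: "\<forall>g\<in>carrier \<Gamma>. graph_automorphism V adj (\<phi> g)"
  defines "\<Gamma>0 \<equiv> stabilizer \<Gamma> \<phi> v0"
    and "S \<equiv> \<lambda>n. {g \<in> carrier \<Gamma>. graph_dist V adj (\<phi> g v0) v0 = n}"
    and "T \<equiv> \<lambda>n. hecke_basis (S n)"
  assumes proper: "\<Gamma>0 \<noteq> carrier \<Gamma>"
    and sphere_trans: "\<forall>n. \<forall>x \<in> graph_sphere V adj v0 n. \<forall>y \<in> graph_sphere V adj v0 n.
                          \<exists>g\<in>\<Gamma>0. \<phi> g x = y"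
  shows "semi_homogeneous V adj
    \<and> hecke_pair \<Gamma> \<Gamma>0
    \<and> (card (orbits \<Gamma> V \<phi>) = 1 \<or> card (orbits \<Gamma> V \<phi>) = 2)
    \<and> (transitive_action \<Gamma> V \<phi> \<longrightarrow> homogeneous V adj \<and> canonical_basis \<Gamma> \<Gamma>0 = {T n | n. True})
    \<and> (card (orbits \<Gamma> V \<phi>) = 2 \<longrightarrow> canonical_basis \<Gamma> \<Gamma>0 = {T (2 * n) | n. True})
    \<and> (\<forall>q0 q1 :: nat.
         (\<forall>x\<in>V. even (graph_dist V adj v0 x) \<longrightarrow> graph_degree adj x = q0 + 1) \<and>
         (\<forall>x\<in>V. odd (graph_dist V adj v0 x) \<longrightarrow> graph_degree adj x = q1 + 1) \<longrightarrow>
         (transitive_action \<Gamma> V \<phi> \<longrightarrow>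
            (let q = (of_nat q0 :: complex) in
             \<forall>m n. m \<ge> n \<and> n > 0 \<longrightarrow>
               hecke_mult \<Gamma> \<Gamma>0 (T n) (T m) = hecke_mult \<Gamma> \<Gamma>0 (T m) (T n) \<and>
               hecke_mult \<Gamma> \<Gamma>0 (T m) (T n) =
                 T (m + n)
                 + (q ^ (n - 1) * (q + (if m = n then 1 else 0))) *\<^sub>H T (m - n)
                 + (q - 1) *\<^sub>H (\<Sum>l = 1..n - 1. q ^ (l - 1) *\<^sub>H T (m + n - 2 * l)))) \<and>
         (card (orbits \<Gamma> V \<phi>) = 2 \<longrightarrow>
            (let q = (\<lambda>l. of_nat (if even l then q0 else q1) :: complex) in
             \<forall>m n. m \<ge> n \<and> n > 0 \<longrightarrow>
               hecke_mult \<Gamma> \<Gamma>0 (T (2 * n)) (T (2 * m)) = hecke_mult \<Gamma> \<Gamma>0 (T (2 * m)) (T (2 * n)) \<and>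
               hecke_mult \<Gamma> \<Gamma>0 (T (2 * m)) (T (2 * n)) =
                 T (2 * (m + n))
                 + (q 1 ^ n * q 0 ^ (n - 1) * (q 0 + (if m = n then 1 else 0))) *\<^sub>H T (2 * (m - n))
                 + (\<Sum>l = 1..2 * n - 1.
                      ((q l - 1) * (\<Prod>i = 1..l - 1. q i)) *\<^sub>H T (2 * (m + n - l))))))"
proof -
  interpret A: tree_action V adj \<Gamma> \<phi> v0
    using tree lf deg3 v0 act aut proper sphere_trans
    unfolding tree_action_def tree_graph_def tree_action_axioms_def locally_finite_graph_def
      graph_degree_def \<Gamma>0_def graph_sphere_def
    by auto
  have S: "S = A.S" unfolding S_def A.S_def by (rule refl)
  have deg: "graph_degree adj x = graph_degree adj y"
    if "x \<in> V" "y \<in> V" "even (graph_dist V adj v0 x) \<longleftrightarrow> even (graph_dist V adj v0 y)" for x y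
    using A.card_nbrs_parity that unfolding graph_degree_def by blast
  have semi: "semi_homogeneous V adj"
    unfolding semi_homogeneous_def
  proof (intro ballI impI)
    fix x y assume "x \<in> V" "y \<in> V" "even (graph_dist V adj x y)"
    then show "graph_degree adj x = graph_degree adj y"
      using A.dist_parity[OF v0, of x y] by (intro deg) auto
  qed
  have pair: "hecke_pair \<Gamma> \<Gamma>0"
    using A.hecke_pair_stabilizer unfolding \<Gamma>0_def .
  have one: "card (orbits \<Gamma> V \<phi>) = 1" if "transitive_action \<Gamma> V \<phi>"
    using transitive_action.one_orbit[OF that] v0 by blast
  \<comment> \<open>If \<open>K\<close> were everything, the action would be transitive and have a
    single orbit.\<close>
  have two: "A.K = {n. even n}" if "card (orbits \<Gamma> V \<phi>) = 2"
    using that one A.K_cases A.transitive_iff by auto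
  have orbits: "card (orbits \<Gamma> V \<phi>) = 1 \<or> card (orbits \<Gamma> V \<phi>) = 2"
    using A.K_cases A.transitive_iff one A.orbits_two by blast
  have basis: "canonical_basis \<Gamma> \<Gamma>0 = T ` A.K"
    unfolding canonical_basis_def \<Gamma>0_def A.double_cosets_eq T_def S by (simp add: image_image)
  have homog: "homogeneous V adj" if t: "transitive_action \<Gamma> V \<phi>"
    unfolding homogeneous_def graph_degree_def
    using transitive_action.unique_orbit[OF t] A.card_nbrs_act by metis
  have basis1: "canonical_basis \<Gamma> \<Gamma>0 = {T n | n. True}" if "transitive_action \<Gamma> V \<phi>"
    using basis that A.transitive_iff by auto
  have basis2: "canonical_basis \<Gamma> \<Gamma>0 = {T (2 * n) | n. True}" if "card (orbits \<Gamma> V \<phi>) = 2"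
    using basis two[OF that] by (auto elim!: evenE)
  have table:
    "(transitive_action \<Gamma> V \<phi> \<longrightarrow>
            (let q = (of_nat q0 :: complex) in
             \<forall>m n. m \<ge> n \<and> n > 0 \<longrightarrow>
               hecke_mult \<Gamma> \<Gamma>0 (T n) (T m) = hecke_mult \<Gamma> \<Gamma>0 (T m) (T n) \<and>
               hecke_mult \<Gamma> \<Gamma>0 (T m) (T n) =
                 T (m + n)
                 + (q ^ (n - 1) * (q + (if m = n then 1 else 0))) *\<^sub>H T (m - n)
                 + (q - 1) *\<^sub>H (\<Sum>l = 1..n - 1. q ^ (l - 1) *\<^sub>H T (m + n - 2 * l)))) \<and>
         (card (orbits \<Gamma> V \<phi>) = 2 \<longrightarrow>
            (let q = (\<lambda>l. of_nat (if even l then q0 else q1) :: complex) in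
             \<forall>m n. m \<ge> n \<and> n > 0 \<longrightarrow>
               hecke_mult \<Gamma> \<Gamma>0 (T (2 * n)) (T (2 * m)) = hecke_mult \<Gamma> \<Gamma>0 (T (2 * m)) (T (2 * n)) \<and>
               hecke_mult \<Gamma> \<Gamma>0 (T (2 * m)) (T (2 * n)) =
                 T (2 * (m + n))
                 + (q 1 ^ n * q 0 ^ (n - 1) * (q 0 + (if m = n then 1 else 0))) *\<^sub>H T (2 * (m - n))
                 + (\<Sum>l = 1..2 * n - 1.
                      ((q l - 1) * (\<Prod>i = 1..l - 1. q i)) *\<^sub>H T (2 * (m + n - l)))))"
    if q: "\<forall>x\<in>V. even (graph_dist V adj v0 x) \<longrightarrow> graph_degree adj x = q0 + 1"
      "\<forall>x\<in>V. odd (graph_dist V adj v0 x) \<longrightarrow> graph_degree adj x = q1 + 1" for q0 q1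
  proof -
    interpret B: biregular_tree_action V adj \<Gamma> \<phi> v0 q0 q1
      by (intro biregular_tree_action.intro biregular_tree.intro biregular_tree_axioms.intro
          A.tree_action_axioms A.tree_graph_axioms)
        (use q v0 A.locally_finite in \<open>simp_all add: graph_degree_def\<close>)
    have case1: "hecke_mult \<Gamma> \<Gamma>0 (T n) (T m) = hecke_mult \<Gamma> \<Gamma>0 (T m) (T n) \<and>
        hecke_mult \<Gamma> \<Gamma>0 (T m) (T n) = T (m + n)
          + (of_nat q0 ^ (n - 1) * (of_nat q0 + (if m = n then 1 else 0))) *\<^sub>H T (m - n)
          + (of_nat q0 - 1) *\<^sub>H (\<Sum>l = 1..n - 1. of_nat q0 ^ (l - 1) *\<^sub>H T (m + n - 2 * l))"
      if t: "transitive_action \<Gamma> V \<phi>" and mn: "n \<le> m" "0 < n" for m n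
    proof -
      have K: "A.K = UNIV" using A.transitive_iff t by blast
      obtain v1 where v1: "v1 \<in> V" "graph_dist V adj v0 v1 = 1" using A.sphere_nonempty by blast
      \<comment> \<open>Homogeneity is applied to \<open>v0\<close> and a vertex at distance 1; the
        equality discharges the parity conditions for all \<open>m\<close> and
        \<open>n\<close>.\<close>
      have eq: "q0 = q1"
      proof -
        have "graph_degree adj v0 = q0 + 1" using q(1) v0 A.dist_self[OF v0] by simp
        moreover have "graph_degree adj v1 = q1 + 1" using q(2) v1 by simp
        moreover have "graph_degree adj v0 = graph_degree adj v1"
          using homog[OF t] v0 v1(1) unfolding homogeneous_def by blast
        ultimately show ?thesis by simp
      qed
      then have "B.q l = q0" for l unfolding B.q_def by simp
      then show ?thesis
        using B.hecke_mult_S[of m n, where 'r = complex] B.hecke_mult_commute[of m n, where 'r = complex] K eq mn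
        unfolding T_def S \<Gamma>0_def
        by (simp add: hecke_scale_sum hecke_scale_scale mult.commute)
    qed
    have case2: "hecke_mult \<Gamma> \<Gamma>0 (T (2 * n)) (T (2 * m)) = hecke_mult \<Gamma> \<Gamma>0 (T (2 * m)) (T (2 * n)) \<and>
        hecke_mult \<Gamma> \<Gamma>0 (T (2 * m)) (T (2 * n)) = T (2 * (m + n))
          + (of_nat q1 ^ n * of_nat q0 ^ (n - 1) * (of_nat q0 + (if m = n then 1 else 0))) *\<^sub>H T (2 * (m - n))
          + (\<Sum>l = 1..2 * n - 1.
              ((of_nat (B.q l) - 1) * (\<Prod>i = 1..l - 1. of_nat (B.q i))) *\<^sub>H T (2 * (m + n - l)))"
      if t: "card (orbits \<Gamma> V \<phi>) = 2" and mn: "n \<le> m" "0 < n" for m n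
    proof -
      have K: "A.K = {n. even n}" using two[OF t] .
      \<comment> \<open>This puts \<open>2 * n - 1\<close> into the form \<open>2 * n' + 1\<close>
        of \<open>prod_q_odd\<close>.\<close>
      obtain n' where n': "n = Suc n'" using mn by (cases n) auto
      have "(\<Prod>i=1..2 * n - 1. of_nat (B.q i)) = (of_nat q1 ^ n * of_nat q0 ^ (n - 1) :: complex)"
        using B.prod_q_odd[of n', where 'r = complex] n' by simp
      moreover have "B.q (2 * n) = q0" unfolding B.q_def by simp
      ultimately show ?thesis
        using B.hecke_mult_S[of "2 * m" "2 * n", where 'r = complex]
          B.hecke_mult_commute[of "2 * m" "2 * n", where 'r = complex] K mn
        unfolding T_def S \<Gamma>0_def
        by (simp add: mult.commute diff_mult_distrib diff_mult_distrib2 distrib_left distrib_right)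
    qed
    show ?thesis
      using case1 case2 unfolding Let_def B.q_def by simp
  qed
  show ?thesis
    using semi pair orbits homog basis1 basis2 table by blast
qed

end
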